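(* Let $k\ge 2$ and a set $R_k=\{c_1,\dots,c_k\}\subset\mathbb{R}$ of $k$ distinct real numbers be fixed. For each $n$, let $n_1\ge n_2\ge\cdots\ge n_k$ be positive integers (depending on $n$) with $\sum_{i=1}^k n_i=n$, and assume that there is a constant $c>0$ independent of $n$ with $\frac{n_k}{n}\ge c$ for all $n$. Let $y\in\Omega_{n_1,\dots,n_k}$ (the true color assignment function), let $\sigma\in\mathbb{R}$ be deterministic (possibly depending on $n$), and let the observation be $$\mathbf{T}=\mathbf{G}(y)+\sigma\mathbf{W},$$ where $\mathbf{W}$ is a random $n\times n$ matrix with i.i.d. standard (real) Gaussian entries. Let $$\hat{y}=\mathrm{argmin}_{x\in\Omega_{n_1,\dots,n_k}}\|\mathbf{T}-\mathbf{G}(x)\|_F^2,\qquad \check{y}=\mathrm{argmin}_{x\in\Omega}\|\mathbf{T}-\mathbf{G}(x)\|_F^2 .$$ Then: (1) If there exists a constant $\delta>0$ independent of $n$ such that $$\sigma^2<\frac{(1-\delta)\,n\,\min_{1\le i<j\le k}(c_i-c_j)^2}{4\log n},$$ then $\lim_{n\to\infty}\Pr(\hat{y}=y)=1$ and $\lim_{n\to\infty}\Pr(\check{y}=y)=1$. (2) If there exists a constant $\delta>0$ independent of $n$ such that $$\sigma^2>\frac{(1+\delta)\,n\,\min_{1\le i<j\le k}(c_i-c_j)^2}{4\log n},$$ then $\lim_{n\to\infty}\Pr(\hat{y}=y)=0$ and $\lim_{n\to\infty}\Pr(\check{y}=y)=0$.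
   Context: $[n]=\{1,\dots,n\}$. $\Omega$ is the set of all mappings $x:[n]\to R_k$ (color assignment mappings). $\Omega_{n_1,\dots,n_k}=\{x:[n]\to R_k : |x^{-1}(c_i)|=n_i\ \text{for all }1\le i\le k\}$. For $x\in\Omega$, $\mathbf{G}(x)$ is the $n\times n$ matrix with entries $\mathbf{G}_{i,j}(x)=x(i)-x(j)$, $1\le i,j\le n$. The Frobenius norm is $\|A\|_F=\sqrt{\sum_{i,j}|A_{ij}|^2}$. *)

theory Defs
  imports "HOL-Probability.Probability"
begin

text \<open>Vertices are \<open>{1..n}\<close>; the set \<open>R\<^sub>k\<close> of colours is listed by \<open>c\<close> on \<open>{1..k}\<close>.
  Assignments are extensional functions, so that equality of functions is equality on \<open>{1..n}\<close>.\<close>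

definition assignments :: "nat \<Rightarrow> real set \<Rightarrow> (nat \<Rightarrow> real) set" where
  "assignments n R = {1..n} \<rightarrow>\<^sub>E R"

definition sized_assignments ::
    "nat \<Rightarrow> nat \<Rightarrow> (nat \<Rightarrow> real) \<Rightarrow> (nat \<Rightarrow> nat) \<Rightarrow> (nat \<Rightarrow> real) set" where
  "sized_assignments n k c m =
     {x \<in> assignments n (c ` {1..k}). \<forall>i\<in>{1..k}. card {v \<in> {1..n}. x v = c i} = m i}"

text \<open>An \<open>n \<times> n\<close> matrix is a function of two indices, of which only the values on
  \<open>{1..n} \<times> {1..n}\<close> matter.\<close>

definition diff_matrix :: "(nat \<Rightarrow> real) \<Rightarrow> nat \<Rightarrow> nat \<Rightarrow> real" where
  "diff_matrix x i j = x i - x j"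

definition frobenius_norm :: "nat \<Rightarrow> (nat \<Rightarrow> nat \<Rightarrow> real) \<Rightarrow> real" where
  "frobenius_norm n A = sqrt (\<Sum>i\<in>{1..n}. \<Sum>j\<in>{1..n}. \<bar>A i j\<bar>\<^sup>2)"

definition observation ::
    "(nat \<Rightarrow> real) \<Rightarrow> real \<Rightarrow> (nat \<Rightarrow> nat \<Rightarrow> 'w \<Rightarrow> real) \<Rightarrow> 'w \<Rightarrow> nat \<Rightarrow> nat \<Rightarrow> real" where
  "observation y s W \<omega> i j = diff_matrix y i j + s * W i j \<omega>"

definition iid_std_gaussian_matrix ::
    "'w measure \<Rightarrow> nat \<Rightarrow> (nat \<Rightarrow> nat \<Rightarrow> 'w \<Rightarrow> real) \<Rightarrow> bool" where
  "iid_std_gaussian_matrix M n W \<longleftrightarrow>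
     prob_space.indep_vars M (\<lambda>_. borel) (\<lambda>(i, j). W i j) ({1..n} \<times> {1..n}) \<and>
     (\<forall>i\<in>{1..n}. \<forall>j\<in>{1..n}. distributed M lborel (W i j) std_normal_density)"

text \<open>\<open>\<omega> \<mapsto> z \<omega>\<close> is an argmin over \<open>X\<close> of \<open>x \<mapsto> \<parallel>T - G(x)\<parallel>\<^sub>F\<^sup>2\<close>. The minimiser may fail to be unique
  on some outcomes; there any choice is allowed, as long as \<open>z\<close> is a random variable.\<close>

definition least_squares_estimator ::
    "'w measure \<Rightarrow> nat \<Rightarrow> ('w \<Rightarrow> nat \<Rightarrow> nat \<Rightarrow> real) \<Rightarrow> (nat \<Rightarrow> real) set \<Rightarrow>
     ('w \<Rightarrow> nat \<Rightarrow> real) \<Rightarrow> bool" where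
  "least_squares_estimator M n T X z \<longleftrightarrow>
     z \<in> measurable M (count_space X) \<and>
     (\<forall>\<omega>\<in>space M. is_arg_min
        (\<lambda>x. (frobenius_norm n (\<lambda>i j. T \<omega> i j - diff_matrix x i j))\<^sup>2) (\<lambda>x. x \<in> X) (z \<omega>))"

definition min_sq_gap :: "nat \<Rightarrow> (nat \<Rightarrow> real) \<Rightarrow> real" where
  "min_sq_gap k c = Min {(c i - c j)\<^sup>2 | i j. 1 \<le> i \<and> i < j \<and> j \<le> k}"

end

theory Submission
  imports Defs "HOL-Real_Asymp.Real_Asymp"
begin

text \<open>
  Write \<open>d = y - x\<close> and \<open>N = \<parallel>G(d)\<parallel>\<^sup>2\<close>. The loss of \<open>x\<close> exceeds that of \<open>y\<close> by
  \<open>N + 2 \<sigma> \<langle>G(d), W\<rangle>\<close>, a Gaussian variable, so \<open>x\<close> beats \<open>y\<close> with probability at most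
  \<open>exp (- N / (8 \<sigma>\<^sup>2))\<close>.

  Below the threshold a union bound over all \<open>x\<close> suffices. If \<open>x\<close> differs from \<open>y\<close> in \<open>l < (\<delta>/2) n\<close>
  vertices, then \<open>N \<ge> 2 l (n - l) g\<close>, with \<open>g\<close> the least squared gap, and the bound is \<open>r ^ l\<close> with
  \<open>r = n powr - (1 + \<delta>/2)\<close>; these terms sum to \<open>(1 + (k - 1) r) ^ n - 1\<close>. Otherwise no value is taken by
  \<open>d\<close> on almost all vertices (a nonzero value \<open>t\<close> is impossible on one of the two extreme colour
  classes), so \<open>N\<close> is of order \<open>n\<^sup>2\<close> and the bound \<open>exp (- C n ln n)\<close> beats the \<open>k ^ n\<close> assignments.

  Above the threshold, let \<open>p\<close>, \<open>q\<close> be two colours at minimal distance and exchange the colours of a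
  vertex \<open>u\<close> coloured \<open>p\<close> and a vertex \<open>v\<close> coloured \<open>q\<close>. This changes the loss by
  \<open>4 n (p - q)\<^sup>2 + 2 \<sigma> (p - q) (X\<^sub>u - X\<^sub>v)\<close> with \<open>X\<^sub>u = \<Sum>\<^sub>j (W\<^sub>u\<^sub>j - W\<^sub>j\<^sub>u)\<close>. The \<open>X\<^sub>u\<close> are not independent,
  but for \<open>u\<close> in a set \<open>S\<close> of \<open>\<eta> n\<close> vertices the parts of the sums with \<open>j \<notin> S\<close> are, and the parts
  with \<open>j \<in> S\<close> are uniformly small when \<open>\<eta>\<close> is. Hence some \<open>X\<^sub>u\<close> exceeds \<open>n \<bar>p - q\<bar> / \<bar>\<sigma>\<bar>\<close> in the
  required direction with probability tending to one, and likewise for \<open>v\<close>.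
\<close>

subsection \<open>Gaussian tails\<close>

text \<open>The cross term \<open>2 * t * (x - t)\<close> in the expansion of
  \<open>x\<^sup>2\<close> about \<open>t\<close> is nonnegative. Comparing with the density centred
  at \<open>t\<close>, which has total mass 1, makes the tail bound a pure exponential with no
  prefactor.\<close>

lemma normal_density_shift_le:
  assumes "0 < s" "0 \<le> t" "t \<le> x"
  shows "normal_density 0 s x \<le> exp (- t\<^sup>2 / (2 * s\<^sup>2)) * normal_density t s x"
proof -
  have "- x\<^sup>2 \<le> - t\<^sup>2 - (x - t)\<^sup>2"
    using mult_nonneg_nonneg[of t "x - t"] assms by (simp add: power2_eq_square algebra_simps)
  then have "- x\<^sup>2 / (2 * s\<^sup>2) \<le> (- t\<^sup>2 - (x - t)\<^sup>2) / (2 * s\<^sup>2)"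
    by (intro divide_right_mono) auto
  then have "exp (- x\<^sup>2 / (2 * s\<^sup>2)) \<le> exp (- t\<^sup>2 / (2 * s\<^sup>2)) * exp (- (x - t)\<^sup>2 / (2 * s\<^sup>2))"
    by (simp add: diff_divide_distrib flip: exp_add)
  then have "1 / sqrt (2 * pi * s\<^sup>2) * exp (- x\<^sup>2 / (2 * s\<^sup>2))
      \<le> 1 / sqrt (2 * pi * s\<^sup>2) * (exp (- t\<^sup>2 / (2 * s\<^sup>2)) * exp (- (x - t)\<^sup>2 / (2 * s\<^sup>2)))"
    by (intro mult_left_mono) auto
  then show ?thesis
    by (simp add: normal_density_def mult_ac)
qed

lemma (in prob_space) normal_upper_tail:
  assumes X: "distributed M lborel X (normal_density 0 s)" and s: "0 < s" and t: "0 \<le> t"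
  shows "prob {\<omega> \<in> space M. t \<le> X \<omega>} \<le> exp (- t\<^sup>2 / (2 * s\<^sup>2))"
proof -
  have "emeasure M (X -` {t..} \<inter> space M) =
      (\<integral>\<^sup>+x. ennreal (normal_density 0 s x) * indicator {t..} x \<partial>lborel)"
    using X by (intro distributed_emeasure) auto
  also have "\<dots> \<le> (\<integral>\<^sup>+x. ennreal (exp (- t\<^sup>2 / (2 * s\<^sup>2))) * ennreal (normal_density t s x) \<partial>lborel)"
    using normal_density_shift_le[OF s t]
    by (intro nn_integral_mono) (auto simp: indicator_def simp flip: ennreal_mult')
  also have "\<dots> = ennreal (exp (- t\<^sup>2 / (2 * s\<^sup>2)))"
    using s by (subst nn_integral_cmult) (auto simp: nn_integral_eq_integral)
  finally show ?thesis
    by (simp add: emeasure_eq_measure vimage_def Int_def conj_commute)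
qed

text \<open>Only the window from \<open>t\<close> to \<open>t + s\<close> is kept: its length is one
  standard deviation and the density on it is least at the right end. The crude prefactor is
  harmless for the limits.\<close>

lemma (in prob_space) normal_lower_tail:
  assumes X: "distributed M lborel X (normal_density 0 s)" and s: "0 < s" and t: "0 \<le> t"
  shows "exp (- (t / s + 1)\<^sup>2 / 2) / sqrt (2 * pi) \<le> prob {\<omega> \<in> space M. t < X \<omega>}"
proof -
  have dens: "normal_density 0 s (t + s) \<le> normal_density 0 s x" if "x \<in> {t<..t+s}" for x
  proof -
    have "x\<^sup>2 \<le> (t + s)\<^sup>2"
      using that s t by (intro power_mono) auto
    then have "- (t+s)\<^sup>2 / (2 * s\<^sup>2) \<le> - x\<^sup>2 / (2 * s\<^sup>2)"
      by (intro divide_right_mono) auto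
    then show ?thesis
      using s by (simp add: normal_density_def divide_right_mono)
  qed
  have "exp (- (t / s + 1)\<^sup>2 / 2) / sqrt (2 * pi) = normal_density 0 s (t + s) * s"
  proof -
    have "t / s + 1 = (t + s) / s"
      using s by (simp add: field_simps)
    then show ?thesis
      using s by (simp add: normal_density_def real_sqrt_mult power_divide)
  qed
  then have "ennreal (exp (- (t / s + 1)\<^sup>2 / 2) / sqrt (2 * pi))
      = (\<integral>\<^sup>+x. ennreal (normal_density 0 s (t + s)) * indicator {t<..t+s} x \<partial>lborel)"
    using s by (simp add: nn_integral_cmult_indicator ennreal_mult')
  also have "\<dots> \<le> (\<integral>\<^sup>+x. ennreal (normal_density 0 s x) * indicator {t<..} x \<partial>lborel)"
    using dens by (intro nn_integral_mono) (auto simp: indicator_def intro!: ennreal_leI)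
  also have "\<dots> = emeasure M (X -` {t<..} \<inter> space M)"
    using X by (intro distributed_emeasure[symmetric]) auto
  finally show ?thesis
    by (simp add: emeasure_eq_measure vimage_def Int_def conj_commute)
qed

section \<open>Linear forms in independent standard Gaussian variables\<close>

lemma (in prob_space) linear_form_distributed:
  assumes I: "finite I" and ind: "indep_vars (\<lambda>_. borel) X I"
    and std: "\<And>i. i \<in> I \<Longrightarrow> distributed M lborel (X i) std_normal_density"
    and pos: "0 < (\<Sum>i\<in>I. (a i)\<^sup>2)"
  shows "distributed M lborel (\<lambda>\<omega>. \<Sum>i\<in>I. a i * X i \<omega>)
           (normal_density 0 (sqrt (\<Sum>i\<in>I. (a i)\<^sup>2)))"
proof -
  \<comment> \<open>A summand with coefficient 0 is a point mass and has no density, so such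
    summands are dropped before the convolution result \<open>sum_indep_normal\<close> is
    applied.\<close>
  define J where "J = {i \<in> I. a i \<noteq> 0}"
  have J: "finite J" "J \<subseteq> I" "\<And>i. i \<in> J \<Longrightarrow> a i \<noteq> 0"
    using I by (auto simp: J_def)
  have sum_J: "(\<Sum>i\<in>J. f i) = (\<Sum>i\<in>I. f i)" if "\<And>i. a i = 0 \<Longrightarrow> f i = 0" for f :: "_ \<Rightarrow> real"
    using that I by (intro sum.mono_neutral_left) (auto simp: J_def)
  have "J \<noteq> {}"
    using pos sum_J[of "\<lambda>i. (a i)\<^sup>2"] by auto
  moreover have "indep_vars (\<lambda>_. borel) (\<lambda>i \<omega>. a i * X i \<omega>) J"
    by (rule indep_vars_compose2[OF indep_vars_subset[OF ind J(2)]]) auto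
  moreover have "distributed M lborel (\<lambda>\<omega>. a i * X i \<omega>) (normal_density 0 \<bar>a i\<bar>)" if "i \<in> J" for i
    using normal_density_affine[OF std, of i "a i" 0] J that by auto
  ultimately have "distributed M lborel (\<lambda>\<omega>. \<Sum>i\<in>J. a i * X i \<omega>)
      (normal_density (\<Sum>i\<in>J. 0) (sqrt (\<Sum>i\<in>J. \<bar>a i\<bar>\<^sup>2)))"
    using J by (intro sum_indep_normal) auto
  then show ?thesis
    using sum_J[of "\<lambda>i. (a i)\<^sup>2"] sum_J[of "\<lambda>i. a i * X i _"] by simp
qed

text \<open>The bound increases with the variance, so any positive upper bound \<open>V\<close> will
  do. This includes a vanishing form: its event is empty for \<open>t > 0\<close>, and for
  \<open>t = 0\<close> the bound equals 1.\<close>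

lemma (in prob_space) linear_form_upper_tail:
  assumes I: "finite I" and ind: "indep_vars (\<lambda>_. borel) X I"
    and std: "\<And>i. i \<in> I \<Longrightarrow> distributed M lborel (X i) std_normal_density"
    and V: "(\<Sum>i\<in>I. (a i)\<^sup>2) \<le> V" "0 < V" and t: "0 \<le> t"
  shows "prob {\<omega> \<in> space M. t \<le> (\<Sum>i\<in>I. a i * X i \<omega>)} \<le> exp (- t\<^sup>2 / (2 * V))"
proof (cases "(\<Sum>i\<in>I. (a i)\<^sup>2) = 0")
  case True
  then have "a i = 0" if "i \<in> I" for i
    using that I by (simp add: sum_nonneg_eq_0_iff)
  then show ?thesis
    using t by (cases "t = 0") auto
next
  case False
  then have pos: "0 < (\<Sum>i\<in>I. (a i)\<^sup>2)"
    by (simp add: order_less_le sum_nonneg)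
  have "prob {\<omega> \<in> space M. t \<le> (\<Sum>i\<in>I. a i * X i \<omega>)}
      \<le> exp (- t\<^sup>2 / (2 * (sqrt (\<Sum>i\<in>I. (a i)\<^sup>2))\<^sup>2))"
    using pos t linear_form_distributed[OF I ind std pos] by (intro normal_upper_tail) auto
  also have "\<dots> \<le> exp (- t\<^sup>2 / (2 * V))"
    using pos V by (auto intro!: divide_left_mono)
  finally show ?thesis .
qed

lemma (in prob_space) linear_form_lower_tail:
  assumes I: "finite I" and ind: "indep_vars (\<lambda>_. borel) X I"
    and std: "\<And>i. i \<in> I \<Longrightarrow> distributed M lborel (X i) std_normal_density"
    and V: "V \<le> (\<Sum>i\<in>I. (a i)\<^sup>2)" "0 < V" and t: "0 \<le> t"
  shows "exp (- (t / sqrt V + 1)\<^sup>2 / 2) / sqrt (2 * pi)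
           \<le> prob {\<omega> \<in> space M. t < (\<Sum>i\<in>I. a i * X i \<omega>)}"
proof -
  let ?s = "sqrt (\<Sum>i\<in>I. (a i)\<^sup>2)"
  have pos: "0 < (\<Sum>i\<in>I. (a i)\<^sup>2)"
    using V by linarith
  have "t / ?s \<le> t / sqrt V"
    using V t pos by (intro divide_left_mono) auto
  then have "(t / ?s + 1)\<^sup>2 \<le> (t / sqrt V + 1)\<^sup>2"
    using t pos by (intro power_mono) auto
  then have "exp (- (t / sqrt V + 1)\<^sup>2 / 2) / sqrt (2 * pi)
      \<le> exp (- (t / ?s + 1)\<^sup>2 / 2) / sqrt (2 * pi)"
    by (intro divide_right_mono) auto
  also have "\<dots> \<le> prob {\<omega> \<in> space M. t < (\<Sum>i\<in>I. a i * X i \<omega>)}"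
    using pos t linear_form_distributed[OF I ind std pos] by (intro normal_lower_tail) auto
  finally show ?thesis .
qed

subsection \<open>The loss and its differences\<close>

text \<open>The squared Frobenius norm of \<open>diff_matrix d\<close>, written as one sum over
  pairs so that it shares its index set with the noise variables.\<close>

definition spread :: "nat \<Rightarrow> (nat \<Rightarrow> real) \<Rightarrow> real" where
  "spread n d = (\<Sum>(i, j)\<in>{1..n} \<times> {1..n}. (d i - d j)\<^sup>2)"

abbreviation loss ::
    "nat \<Rightarrow> (nat \<Rightarrow> real) \<Rightarrow> real \<Rightarrow> (nat \<Rightarrow> nat \<Rightarrow> 'w \<Rightarrow> real) \<Rightarrow> (nat \<Rightarrow> real) \<Rightarrow> 'w \<Rightarrow> real" where
  "loss n y s W x \<omega> \<equiv>
     (frobenius_norm n (\<lambda>i j. observation y s W \<omega> i j - diff_matrix x i j))\<^sup>2"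

lemma loss_eq:
  "loss n y s W x \<omega> = (\<Sum>(i, j)\<in>{1..n} \<times> {1..n}. ((y i - x i) - (y j - x j) + s * W i j \<omega>)\<^sup>2)"
  unfolding frobenius_norm_def observation_def diff_matrix_def
  by (subst real_sqrt_pow2)
     (auto intro!: sum_nonneg sum.cong arg_cong[where f = "\<lambda>t. t\<^sup>2"] simp: sum.cartesian_product)

text \<open>At \<open>x = y\<close> only the noise remains in the loss, so expanding each square
  leaves exactly a deterministic and a linear Gaussian term.\<close>

lemma loss_diff:
  "loss n y s W x \<omega> = loss n y s W y \<omega> + spread n (\<lambda>i. y i - x i)
     + 2 * s * (\<Sum>(i, j)\<in>{1..n} \<times> {1..n}. ((y i - x i) - (y j - x j)) * W i j \<omega>)"
  unfolding loss_eq spread_def sum_distrib_left sum.distrib[symmetric]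
  by (intro sum.cong) (auto simp: power2_sum power_mult_distrib mult_ac)

lemma spread_nonneg: "0 \<le> spread n d"
  unfolding spread_def by (intro sum_nonneg) auto

lemma iid_std_gaussian_matrixD:
  assumes "iid_std_gaussian_matrix M n W"
  shows "prob_space.indep_vars M (\<lambda>_. borel) (\<lambda>p. W (fst p) (snd p)) ({1..n} \<times> {1..n})"
    and "p \<in> {1..n} \<times> {1..n} \<Longrightarrow> distributed M lborel (W (fst p) (snd p)) std_normal_density"
  using assms unfolding iid_std_gaussian_matrix_def by (auto simp: case_prod_beta')

lemma (in prob_space) gaussian_matrix_measurable:
  assumes "iid_std_gaussian_matrix M n W" "i \<in> {1..n}" "j \<in> {1..n}"
  shows "W i j \<in> borel_measurable M"
  using iid_std_gaussian_matrixD(2)[OF assms(1), of "(i, j)"] assms(2,3)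
  by (auto dest: distributed_measurable)

lemma (in prob_space) loss_measurable:
  assumes "iid_std_gaussian_matrix M n W"
  shows "loss n y s W x \<in> borel_measurable M"
  unfolding loss_eq case_prod_beta'
  by (intro borel_measurable_sum borel_measurable_power borel_measurable_add borel_measurable_times
      borel_measurable_const gaussian_matrix_measurable[OF assms]) auto

text \<open>The Gaussian part of the loss difference has variance
  \<open>4 * s\<^sup>2 * N \<le> 4 * B * N\<close>, and it must reach \<open>N\<close> for
  \<open>x\<close> to be at least as good as \<open>y\<close>. Using a positive bound
  \<open>B\<close> instead of \<open>s\<^sup>2\<close> covers \<open>s = 0\<close>.\<close>

lemma (in prob_space) prob_loss_le:
  assumes W: "iid_std_gaussian_matrix M n W" and B: "s\<^sup>2 \<le> B" "0 < B"
  shows "prob {\<omega> \<in> space M. loss n y s W x \<omega> \<le> loss n y s W y \<omega>}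
           \<le> exp (- spread n (\<lambda>i. y i - x i) / (8 * B))"
proof (cases "spread n (\<lambda>i. y i - x i) = 0")
  case False
  define N where "N = spread n (\<lambda>i. y i - x i)"
  have N: "0 < N"
    using False spread_nonneg[of n "\<lambda>i. y i - x i"] unfolding N_def by linarith
  define a where "a p = - 2 * s * ((y (fst p) - x (fst p)) - (y (snd p) - x (snd p)))" for p
  have "(\<Sum>p\<in>{1..n} \<times> {1..n}. (a p)\<^sup>2) = 4 * s\<^sup>2 * N"
    by (simp add: a_def N_def spread_def case_prod_beta' sum_distrib_left power_mult_distrib)
  also have "\<dots> \<le> 4 * B * N"
    using B N by simp
  finally have V: "(\<Sum>p\<in>{1..n} \<times> {1..n}. (a p)\<^sup>2) \<le> 4 * B * N" .
  have sum_a: "(\<Sum>p\<in>{1..n} \<times> {1..n}. a p * W (fst p) (snd p) \<omega>)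
      = - (2 * s * (\<Sum>(i, j)\<in>{1..n} \<times> {1..n}. ((y i - x i) - (y j - x j)) * W i j \<omega>))" for \<omega>
    unfolding a_def case_prod_beta' sum_distrib_left sum_negf[symmetric]
    by (intro sum.cong) (auto simp: algebra_simps)
  have "loss n y s W x \<omega> \<le> loss n y s W y \<omega>
      \<longleftrightarrow> N \<le> (\<Sum>p\<in>{1..n} \<times> {1..n}. a p * W (fst p) (snd p) \<omega>)" for \<omega>
    unfolding sum_a loss_diff[of n y s W \<omega> x] N_def by linarith
  then have "prob {\<omega> \<in> space M. loss n y s W x \<omega> \<le> loss n y s W y \<omega>}
      = prob {\<omega> \<in> space M. N \<le> (\<Sum>p\<in>{1..n} \<times> {1..n}. a p * W (fst p) (snd p) \<omega>)}"
    by (simp only:)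
  also have "\<dots> \<le> exp (- N\<^sup>2 / (2 * (4 * B * N)))"
    using iid_std_gaussian_matrixD[OF W] V B N by (intro linear_form_upper_tail) auto
  also have "\<dots> = exp (- N / (8 * B))"
    using N by (simp add: power2_eq_square)
  finally show ?thesis
    by (simp add: N_def)
qed simp

section \<open>Lower bounds on the spread and counting of assignments\<close>

text \<open>Only the ordered pairs of one changed and one unchanged vertex are counted; for them the
  difference is plus or minus the nonzero value of \<open>d\<close>.\<close>

lemma spread_ge_few_changes:
  assumes g: "\<And>i. i \<in> {1..n} \<Longrightarrow> d i \<noteq> 0 \<Longrightarrow> g \<le> (d i)\<^sup>2"
  defines "l \<equiv> card {i \<in> {1..n}. d i \<noteq> 0}"
  shows "2 * real l * (real n - real l) * g \<le> spread n d"
proof -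
  let ?A = "{i \<in> {1..n}. d i \<noteq> 0}" and ?Z = "{i \<in> {1..n}. d i = 0}"
  have "?A \<union> ?Z = {1..n}" "?A \<inter> ?Z = {}"
    by auto
  then have "l + card ?Z = n"
    unfolding l_def by (subst card_Un_disjoint[symmetric]) auto
  then have "real l + real (card ?Z) = real n"
    by linarith
  then have "2 * real l * (real n - real l) * g = (\<Sum>p\<in>?A \<times> ?Z \<union> ?Z \<times> ?A. g)"
    by (subst sum.union_disjoint) (auto simp: l_def)
  also have "\<dots> \<le> (\<Sum>(i, j)\<in>?A \<times> ?Z \<union> ?Z \<times> ?A. (d i - d j)\<^sup>2)"
    using g by (intro sum_mono) auto
  also have "\<dots> \<le> spread n d"
    unfolding spread_def by (intro sum_mono2) auto
  finally show ?thesis .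
qed

text \<open>Taking \<open>t = d i\<close> in the last hypothesis gives at least
  \<open>\<eta> * n\<close> columns that contribute \<open>g\<close> or more to row
  \<open>i\<close>.\<close>

lemma spread_ge_many_values:
  assumes g: "\<And>i j. i \<in> {1..n} \<Longrightarrow> j \<in> {1..n} \<Longrightarrow> d i \<noteq> d j \<Longrightarrow> g \<le> (d i - d j)\<^sup>2" and "0 \<le> g"
    and \<eta>: "\<And>t. \<eta> * real n \<le> real (card {j \<in> {1..n}. d j \<noteq> t})"
  shows "\<eta> * (real n)\<^sup>2 * g \<le> spread n d"
proof -
  have "\<eta> * (real n)\<^sup>2 * g = (\<Sum>i\<in>{1..n}. \<eta> * real n * g)"
    by (simp add: power2_eq_square)
  also have "\<dots> \<le> (\<Sum>i\<in>{1..n}. real (card {j \<in> {1..n}. d j \<noteq> d i}) * g)"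
    using \<eta> \<open>0 \<le> g\<close> by (intro sum_mono mult_right_mono)
  also have "\<dots> = (\<Sum>i\<in>{1..n}. \<Sum>j\<in>{j \<in> {1..n}. d j \<noteq> d i}. g)"
    by simp
  also have "\<dots> \<le> (\<Sum>i\<in>{1..n}. \<Sum>j\<in>{j \<in> {1..n}. d j \<noteq> d i}. (d i - d j)\<^sup>2)"
    using g by (intro sum_mono) auto
  also have "\<dots> \<le> (\<Sum>i\<in>{1..n}. \<Sum>j\<in>{1..n}. (d i - d j)\<^sup>2)"
    by (intro sum_mono sum_mono2) auto
  finally show ?thesis
    by (simp add: spread_def sum.cartesian_product)
qed

text \<open>The weight is a product over vertices: factor 1 for keeping the colour, \<open>r\<close>
  for each of the \<open>card R - 1\<close> other colours. Exchanging product and sum gives the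
  binomial sum in closed form.\<close>

lemma sum_power_changes:
  fixes r :: real
  assumes R: "finite R" and y: "y \<in> assignments n R"
  shows "(\<Sum>x\<in>assignments n R. r ^ card {i \<in> {1..n}. x i \<noteq> y i})
           = (1 + (real (card R) - 1) * r) ^ n"
proof -
  have yR: "y i \<in> R" if "i \<in> {1..n}" for i
    using y that by (auto simp: assignments_def)
  have prod_eq: "(\<Prod>i\<in>{1..n}. if x i \<noteq> y i then r else 1) = r ^ card {i \<in> {1..n}. x i \<noteq> y i}" for x
    by (subst prod.inter_filter[symmetric]) auto
  have inner: "(\<Sum>c\<in>R. if c \<noteq> y i then r else 1) = 1 + (real (card R) - 1) * r" if "i \<in> {1..n}" for i
  proof -
    have "card R > 0"
      using R yR[OF that] by (auto simp: card_gt_0_iff)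
    then show ?thesis
      using R yR[OF that] by (subst sum.remove[OF R yR[OF that]]) (auto simp: card_Diff_singleton of_nat_diff)
  qed
  have "(1 + (real (card R) - 1) * r) ^ n = (\<Prod>i\<in>{1..n}. \<Sum>c\<in>R. if c \<noteq> y i then r else 1)"
    using inner by simp
  also have "\<dots> = (\<Sum>x\<in>assignments n R. \<Prod>i\<in>{1..n}. if x i \<noteq> y i then r else 1)"
    unfolding assignments_def using R by (intro prod_sum_PiE) auto
  finally show ?thesis
    unfolding prod_eq by (rule sym)
qed

subsection \<open>Recovery below the threshold\<close>

lemma card_shift_ge:
  assumes R: "finite R" and x: "x \<in> assignments n R" and y: "y \<in> assignments n R"
    and classes: "\<And>r. r \<in> R \<Longrightarrow> a \<le> card {i \<in> {1..n}. y i = r}" and "t \<noteq> 0" and n: "n > 0"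
  shows "a \<le> card {i \<in> {1..n}. y i - x i \<noteq> t}"
proof -
  have xR: "x i \<in> R" if "i \<in> {1..n}" for i
    using x that by (auto simp: assignments_def)
  have "R \<noteq> {}"
    using xR[of 1] n by auto
  \<comment> \<open>The colour \<open>Min R\<close> cannot be decreased and \<open>Max R\<close> cannot be increased.\<close>
  have "\<exists>r\<in>R. \<forall>i\<in>{1..n}. y i = r \<longrightarrow> y i - x i \<noteq> t"
  proof (cases "t > 0")
    case True
    have "y i - x i \<noteq> t" if "i \<in> {1..n}" "y i = Min R" for i
      using Min_le[OF R xR[OF that(1)]] that True by linarith
    then show ?thesis
      using R \<open>R \<noteq> {}\<close> by (intro bexI[of _ "Min R"]) auto
  next
    case False
    have "y i - x i \<noteq> t" if "i \<in> {1..n}" "y i = Max R" for i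
      using Max_ge[OF R xR[OF that(1)]] that False \<open>t \<noteq> 0\<close> by linarith
    then show ?thesis
      using R \<open>R \<noteq> {}\<close> by (intro bexI[of _ "Max R"]) auto
  qed
  then obtain r where r: "r \<in> R" "\<forall>i\<in>{1..n}. y i = r \<longrightarrow> y i - x i \<noteq> t"
    by blast
  have "a \<le> card {i \<in> {1..n}. y i = r}"
    using classes r by simp
  also have "\<dots> \<le> card {i \<in> {1..n}. y i - x i \<noteq> t}"
    using r by (intro card_mono) auto
  finally show ?thesis .
qed

text \<open>The cases are fewer or at least \<open>\<epsilon> * n\<close> changed vertices. In the
  second, the value 0 of the difference is avoided on all changed vertices and any other value on a
  whole colour class, which explains \<open>min \<kappa> \<epsilon>\<close>.\<close>

lemma spread_lower_bound:
  fixes \<kappa> \<epsilon> g g' :: real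
  assumes R: "finite R" and x: "x \<in> assignments n R" and y: "y \<in> assignments n R" and n: "n > 0"
    and classes: "\<And>r. r \<in> R \<Longrightarrow> \<kappa> * n \<le> card {i \<in> {1..n}. y i = r}"
    and g: "\<And>p q. p \<in> R \<Longrightarrow> q \<in> R \<Longrightarrow> p \<noteq> q \<Longrightarrow> g \<le> (p - q)\<^sup>2" "0 < g"
    and g': "\<And>p q p' q'. \<lbrakk>p \<in> R; q \<in> R; p' \<in> R; q' \<in> R; p - q \<noteq> p' - q'\<rbrakk>
                \<Longrightarrow> g' \<le> ((p - q) - (p' - q'))\<^sup>2" "0 < g'"
  shows "2 * (1 - \<epsilon>) * n * g * card {i \<in> {1..n}. x i \<noteq> y i} \<le> spread n (\<lambda>i. y i - x i)
       \<or> min \<kappa> \<epsilon> * n\<^sup>2 * g' \<le> spread n (\<lambda>i. y i - x i)"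
proof -
  have xR: "x i \<in> R" "y i \<in> R" if "i \<in> {1..n}" for i
    using x y that by (auto simp: assignments_def)
  define l where "l = card {i \<in> {1..n}. y i - x i \<noteq> 0}"
  have l_eq: "l = card {i \<in> {1..n}. x i \<noteq> y i}"
    unfolding l_def by (intro arg_cong[where f = card]) auto
  show ?thesis
  proof (cases "real l < \<epsilon> * n")
    case True
    have "2 * (1 - \<epsilon>) * n * g * l = 2 * real l * (n - \<epsilon> * n) * g"
      by (simp add: algebra_simps)
    also have "\<dots> \<le> 2 * real l * (n - real l) * g"
      using True g(2) by (intro mult_right_mono mult_left_mono) auto
    also have "\<dots> \<le> spread n (\<lambda>i. y i - x i)"
      unfolding l_def using g xR by (intro spread_ge_few_changes) auto
    finally show ?thesis
      by (simp add: l_eq)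
  next
    case False
    have "min \<kappa> \<epsilon> * real n \<le> card {i \<in> {1..n}. y i - x i \<noteq> t}" for t
    proof (cases "t = 0")
      case True
      have "min \<kappa> \<epsilon> * real n \<le> \<epsilon> * n"
        by (intro mult_right_mono) auto
      then show ?thesis
        using False unfolding l_def True by linarith
    next
      case False
      \<comment> \<open>\<open>card_shift_ge\<close> compares natural numbers; rounding up loses
        nothing because a cardinality is an integer.\<close>
      have "nat \<lceil>\<kappa> * real n\<rceil> \<le> card {i \<in> {1..n}. y i - x i \<noteq> t}"
        using classes by (intro card_shift_ge[OF R x y _ False n]) (simp only: nat_ceiling_le_eq)
      then have "\<kappa> * real n \<le> card {i \<in> {1..n}. y i - x i \<noteq> t}"
        by (simp only: nat_ceiling_le_eq)
      moreover have "min \<kappa> \<epsilon> * real n \<le> \<kappa> * n"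
        by (intro mult_right_mono) auto
      ultimately show ?thesis
        by linarith
    qed
    then have "min \<kappa> \<epsilon> * (real n)\<^sup>2 * g' \<le> spread n (\<lambda>i. y i - x i)"
      using g' xR by (intro spread_ge_many_values) auto
    then show ?thesis
      by simp
  qed
qed

text \<open>Union bound over all competitors. The bounds of the two regimes of
  \<open>spread_lower_bound\<close> are added for every \<open>x\<close>, so the assignments
  themselves need not be split. The term \<open>x = y\<close> of the closed sum is the subtracted
  1.\<close>

lemma (in prob_space) prob_not_unique_minimizer_le:
  fixes \<kappa> \<delta> g g' s :: real
  assumes W: "iid_std_gaussian_matrix M n W"
    and R: "finite R" and y: "y \<in> assignments n R" and n: "n \<ge> 2"
    and classes: "\<And>r. r \<in> R \<Longrightarrow> \<kappa> * n \<le> card {i \<in> {1..n}. y i = r}"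
    and g: "\<And>p q. p \<in> R \<Longrightarrow> q \<in> R \<Longrightarrow> p \<noteq> q \<Longrightarrow> g \<le> (p - q)\<^sup>2" "0 < g"
    and g': "\<And>p q p' q'. \<lbrakk>p \<in> R; q \<in> R; p' \<in> R; q' \<in> R; p - q \<noteq> p' - q'\<rbrakk>
                \<Longrightarrow> g' \<le> ((p - q) - (p' - q'))\<^sup>2" "0 < g'"
    and \<delta>: "0 < \<delta>" "\<delta> < 1"
    and s: "s\<^sup>2 \<le> (1 - \<delta>) * n * g / (4 * ln n)"
  defines "C \<equiv> min \<kappa> (\<delta> / 2) * g' / (2 * (1 - \<delta>) * g)"
  shows "prob (\<Union>x\<in>assignments n R - {y}. {\<omega> \<in> space M. loss n y s W x \<omega> \<le> loss n y s W y \<omega>})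
    \<le> exp (card R * n powr (- \<delta> / 2)) - 1 + real (card R) ^ n * exp (- C * n * ln n)"
proof -
  let ?X = "assignments n R"
  let ?bad = "\<lambda>x. {\<omega> \<in> space M. loss n y s W x \<omega> \<le> loss n y s W y \<omega>}"
  let ?l = "\<lambda>x. card {i \<in> {1..n}. x i \<noteq> y i}"
  define B where "B = (1 - \<delta>) * n * g / (4 * ln n)"
  define r where "r = real n powr (- (1 + \<delta> / 2))"
  have ln: "ln (real n) > 0"
    using n by simp
  have B: "0 < B" "s\<^sup>2 \<le> B"
    using ln n \<delta> g s by (auto simp: B_def)
  have finX: "finite ?X"
    using R by (auto simp: assignments_def intro!: finite_PiE)
  have cardX: "card ?X = card R ^ n"
    unfolding assignments_def by (subst card_PiE) auto
  have bad_le: "prob (?bad x) \<le> r ^ ?l x + exp (- C * n * ln n)" if x: "x \<in> ?X" for x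
  proof -
    let ?N = "spread n (\<lambda>i. y i - x i)"
    have le: "prob (?bad x) \<le> exp (- ?N / (8 * B))"
      using prob_loss_le[OF W B(2,1)] .
    have N_div: "?N / (8 * B) = ?N * ln n / (2 * (1 - \<delta>) * n * g)"
    proof -
      have "8 * B = 2 * (1 - \<delta>) * n * g / ln n"
        by (simp add: B_def)
      then show ?thesis
        by simp
    qed
    have n0: "n > 0"
      using n by simp
    consider "2 * (1 - \<delta> / 2) * n * g * ?l x \<le> ?N" | "min \<kappa> (\<delta> / 2) * n\<^sup>2 * g' \<le> ?N"
      using spread_lower_bound[OF R x y n0 classes g g', of "\<delta> / 2"] by blast
    then show ?thesis
    proof cases
      case 1
      \<comment> \<open>With \<open>\<epsilon> = \<delta> / 2\<close> the spread loses only the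
        factor \<open>1 - \<delta> / 2\<close>, while the noise bound gains
        \<open>1 / (1 - \<delta>)\<close>. The exponent thus stays at least
        \<open>1 + \<delta> / 2\<close>, which makes \<open>n * r\<close> tend to 0.\<close>
      have "(1 + \<delta> / 2) * (1 - \<delta>) \<le> 1 - \<delta> / 2"
        using \<delta> by (simp add: field_simps)
      then have "1 + \<delta> / 2 \<le> (1 - \<delta> / 2) / (1 - \<delta>)"
        using \<delta> by (simp add: field_simps)
      then have "(1 + \<delta> / 2) * (?l x * ln n) \<le> (1 - \<delta> / 2) / (1 - \<delta>) * (?l x * ln n)"
        using ln by (intro mult_right_mono) auto
      also have "\<dots> = (2 * (1 - \<delta> / 2) * n * g * ?l x) * ln n / (2 * (1 - \<delta>) * n * g)"
        using n g \<delta> by (simp add: divide_simps) (simp add: algebra_simps)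
      also have "\<dots> \<le> ?N / (8 * B)"
        unfolding N_div using 1 ln g \<delta> by (intro divide_right_mono mult_right_mono) auto
      finally have "exp (- ?N / (8 * B)) \<le> exp (- ((1 + \<delta> / 2) * (?l x * ln n)))"
        by simp
      also have "\<dots> = r ^ ?l x"
        using n by (simp add: r_def powr_def exp_of_nat_mult[symmetric] algebra_simps)
      finally show ?thesis
        using le by (simp add: add_increasing2)
    next
      case 2
      have "C * n * ln n = (min \<kappa> (\<delta> / 2) * n\<^sup>2 * g') * ln n / (2 * (1 - \<delta>) * n * g)"
        using n g \<delta> by (simp add: C_def divide_simps power2_eq_square)
      also have "\<dots> \<le> ?N / (8 * B)"
        unfolding N_div using 2 ln g \<delta> by (intro divide_right_mono mult_right_mono) auto
      finally have "exp (- ?N / (8 * B)) \<le> exp (- C * n * ln n)"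
        by simp
      moreover have "0 \<le> r ^ ?l x"
        by (simp add: r_def)
      ultimately show ?thesis
        using le by linarith
    qed
  qed
  have "prob (\<Union>x\<in>?X - {y}. ?bad x) \<le> (\<Sum>x\<in>?X - {y}. prob (?bad x))"
    using finX loss_measurable[OF W]
    by (intro finite_measure_subadditive_finite) (auto intro!: borel_measurable_le)
  also have "\<dots> \<le> (\<Sum>x\<in>?X - {y}. r ^ ?l x + exp (- C * n * ln n))"
    using bad_le by (intro sum_mono) auto
  also have "\<dots> = (\<Sum>x\<in>?X - {y}. r ^ ?l x) + (\<Sum>x\<in>?X - {y}. exp (- C * n * ln n))"
    by (rule sum.distrib)
  also have "(\<Sum>x\<in>?X - {y}. r ^ ?l x) = (1 + (real (card R) - 1) * r) ^ n - 1"
    using sum_power_changes[OF R y, of r] sum.remove[OF finX y, of "\<lambda>x. r ^ ?l x"] by simp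
  also have "(1 + (real (card R) - 1) * r) ^ n \<le> exp (card R * n powr (- \<delta> / 2))"
  proof -
    have "card R > 0"
      using y n R by (auto simp: card_gt_0_iff assignments_def PiE_iff)
    then have "0 \<le> (real (card R) - 1) * r" "(real (card R) - 1) * r \<le> real (card R) * r"
      by (auto simp: r_def intro!: mult_nonneg_nonneg mult_right_mono)
    then have "(1 + (real (card R) - 1) * r) ^ n \<le> exp (real (card R) * r) ^ n"
      using exp_ge_add_one_self[of "real (card R) * r"] by (intro power_mono) linarith+
    also have "\<dots> = exp (card R * (n * r))"
      by (simp add: exp_of_nat_mult[symmetric] mult_ac)
    also have "n * r = n powr (- \<delta> / 2)"
      using n powr_add[of "real n" 1 "- (1 + \<delta> / 2)"] by (simp add: r_def)
    finally show ?thesis .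
  qed
  also have "(\<Sum>x\<in>?X - {y}. exp (- C * n * ln n)) \<le> real (card R) ^ n * exp (- C * n * ln n)"
    using finX cardX y by (simp add: card_Diff_singleton)
  finally show ?thesis
    by simp
qed

section \<open>From the union bound to the estimators\<close>

text \<open>Ties belong to the bad event, so off it \<open>y\<close> is the strict minimiser over
  all assignments and hence over any \<open>X\<close> containing it, however ties are
  resolved.\<close>

lemma (in prob_space) estimator_eq_ge:
  assumes est: "least_squares_estimator M n (observation y s W) X z"
    and X: "X \<subseteq> assignments n R" "y \<in> X" and R: "finite R"
    and W: "iid_std_gaussian_matrix M n W"
  shows "1 - prob (\<Union>x\<in>assignments n R - {y}. {\<omega> \<in> space M. loss n y s W x \<omega> \<le> loss n y s W y \<omega>})
    \<le> prob {\<omega> \<in> space M. z \<omega> = y}"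
proof -
  let ?bad = "\<Union>x\<in>assignments n R - {y}. {\<omega> \<in> space M. loss n y s W x \<omega> \<le> loss n y s W y \<omega>}"
  have z: "z \<in> measurable M (count_space X)"
    and arg_min: "\<And>\<omega>. \<omega> \<in> space M \<Longrightarrow> is_arg_min (\<lambda>x. loss n y s W x \<omega>) (\<lambda>x. x \<in> X) (z \<omega>)"
    using est by (auto simp: least_squares_estimator_def)
  have bad: "?bad \<in> events"
    using R loss_measurable[OF W]
    by (intro sets.finite_UN) (auto simp: assignments_def intro!: finite_PiE borel_measurable_le)
  have "space M - ?bad \<subseteq> {\<omega> \<in> space M. z \<omega> = y}"
    using arg_min X by (fastforce simp: is_arg_min_linorder)
  moreover have "z -` {y} \<inter> space M \<in> events"
    using z X by (intro measurable_sets[OF z]) auto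
  then have "{\<omega> \<in> space M. z \<omega> = y} \<in> events"
    by (simp add: vimage_def Int_def conj_commute)
  ultimately have "prob (space M - ?bad) \<le> prob {\<omega> \<in> space M. z \<omega> = y}"
    by (rule finite_measure_mono)
  then show ?thesis
    using prob_compl[OF bad] by simp
qed

lemma union_bound_tendsto_0:
  fixes C \<delta> :: real
  assumes "0 < C" "0 < \<delta>"
  shows "(\<lambda>n. exp (real k * real n powr (- \<delta> / 2)) - 1 + real k ^ n * exp (- C * n * ln n))
           \<longlonglongrightarrow> 0"
proof -
  have small: "(\<lambda>n. exp (real k * real n powr (- \<delta> / 2)) - 1) \<longlonglongrightarrow> 0"
    using assms by real_asymp
  have "(\<lambda>n. real k ^ n * exp (- C * n * ln n)) \<longlonglongrightarrow> 0"
  proof (rule tendsto_sandwich[OF _ _ tendsto_const])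
    show "\<forall>\<^sub>F n in sequentially. real k ^ n * exp (- C * n * ln n) \<le> exp (n * (ln (real k + 1) - C * ln n))"
    proof (intro always_eventually allI)
      fix n
      \<comment> \<open>The base \<open>k + 1\<close> keeps the logarithm meaningful for
        \<open>k = 0\<close>; the term \<open>C * ln n\<close> dominates either way.\<close>
      have "real k ^ n \<le> (real k + 1) ^ n"
        by (intro power_mono) auto
      also have "\<dots> = exp (n * ln (real k + 1))"
        by (simp add: exp_of_nat_mult add_ac)
      finally have "real k ^ n * exp (- C * n * ln n) \<le> exp (n * ln (real k + 1)) * exp (- C * n * ln n)"
        by (intro mult_right_mono) auto
      also have "\<dots> = exp (n * (ln (real k + 1) - C * ln n))"
        by (simp add: algebra_simps flip: exp_add)
      finally show "real k ^ n * exp (- C * n * ln n) \<le> exp (n * (ln (real k + 1) - C * ln n))" .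
    qed
    show "(\<lambda>n. exp (real n * (ln (real k + 1) - C * ln n))) \<longlonglongrightarrow> 0"
      using assms by real_asymp
  qed auto
  from tendsto_add[OF small this] show ?thesis
    by simp
qed

lemma ex_min_positive_sq_diff:
  fixes R :: "real set"
  assumes "finite R"
  shows "\<exists>g>0. \<forall>p\<in>R. \<forall>q\<in>R. p \<noteq> q \<longrightarrow> g \<le> (p - q)\<^sup>2"
proof -
  let ?D = "(\<lambda>(p, q). (p - q)\<^sup>2) ` {(p, q) \<in> R \<times> R. p \<noteq> q}"
  have "finite ?D"
    using finite_subset[of "{(p, q) \<in> R \<times> R. p \<noteq> q}" "R \<times> R"] assms by auto
  \<comment> \<open>Inserting 1 gives \<open>Min\<close> a nonempty set even when \<open>R\<close>
    has fewer than two elements.\<close>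
  then show ?thesis
    by (intro exI[of _ "Min (insert 1 ?D)"]) (auto intro!: Min_le)
qed

text \<open>\<open>X n\<close> ranges between the singleton of \<open>y n\<close> and all
  assignments, so that both estimators are instances.\<close>

lemma exact_recovery_tendsto_1:
  fixes M :: "nat \<Rightarrow> 'w measure" and \<sigma> :: "nat \<Rightarrow> real" and \<kappa> \<delta> g :: real
  assumes k: "k \<ge> 2" and M: "\<And>n. n \<ge> k \<Longrightarrow> prob_space (M n)"
    and W: "\<And>n. n \<ge> k \<Longrightarrow> iid_std_gaussian_matrix (M n) n (W n)"
    and R: "finite R"
    and classes: "\<And>n r. n \<ge> k \<Longrightarrow> r \<in> R \<Longrightarrow> \<kappa> * n \<le> card {i \<in> {1..n}. y n i = r}" "0 < \<kappa>"
    and g: "\<And>p q. p \<in> R \<Longrightarrow> q \<in> R \<Longrightarrow> p \<noteq> q \<Longrightarrow> g \<le> (p - q)\<^sup>2" "0 < g"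
    and \<sigma>: "\<And>n. n \<ge> k \<Longrightarrow> (\<sigma> n)\<^sup>2 \<le> (1 - \<delta>) * n * g / (4 * ln n)" "0 < \<delta>" "\<delta> < 1"
    and X: "\<And>n. n \<ge> k \<Longrightarrow> y n \<in> X n" "\<And>n. n \<ge> k \<Longrightarrow> X n \<subseteq> assignments n R"
    and z: "\<And>n. n \<ge> k \<Longrightarrow>
      least_squares_estimator (M n) n (observation (y n) (\<sigma> n) (W n)) (X n) (z n)"
  shows "(\<lambda>n. measure (M n) {\<omega> \<in> space (M n). z n \<omega> = y n}) \<longlonglongrightarrow> 1"
proof -
  \<comment> \<open>\<open>g'\<close> is a separation between distinct differences of two colours.
    It depends on \<open>R\<close> alone, so \<open>C\<close> is independent of
    \<open>n\<close>.\<close>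
  have "finite ((\<lambda>(p, q). p - q) ` (R \<times> R))"
    using R by simp
  then obtain g' where g'_pos: "0 < g'"
    and g'': "\<forall>d\<in>(\<lambda>(p, q). p - q) ` (R \<times> R). \<forall>d'\<in>(\<lambda>(p, q). p - q) ` (R \<times> R). d \<noteq> d' \<longrightarrow> g' \<le> (d - d')\<^sup>2"
    using ex_min_positive_sq_diff by blast
  have g': "g' \<le> ((p - q) - (p' - q'))\<^sup>2"
    if "p \<in> R" "q \<in> R" "p' \<in> R" "q' \<in> R" "p - q \<noteq> p' - q'" for p q p' q'
    using that g'' by (auto simp: image_iff)
  define C where "C = min \<kappa> (\<delta> / 2) * g' / (2 * (1 - \<delta>) * g)"
  have C: "0 < C"
    using classes(2) \<sigma>(2,3) g(2) g'_pos by (simp add: C_def)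
  define e where "e n = exp (card R * real n powr (- \<delta> / 2)) - 1 + real (card R) ^ n * exp (- C * n * ln n)" for n
  have e: "e \<longlonglongrightarrow> 0"
    unfolding e_def by (rule union_bound_tendsto_0[OF C \<sigma>(2)])
  have lower: "1 - e n \<le> measure (M n) {\<omega> \<in> space (M n). z n \<omega> = y n}" if n: "n \<ge> k" for n
  proof -
    interpret prob_space "M n"
      using M n by simp
    have y: "y n \<in> assignments n R"
      using X n by blast
    have n2: "n \<ge> 2"
      using n k by simp
    have "prob (\<Union>x\<in>assignments n R - {y n}.
        {\<omega> \<in> space (M n). loss n (y n) (\<sigma> n) (W n) x \<omega> \<le> loss n (y n) (\<sigma> n) (W n) (y n) \<omega>}) \<le> e n"
      unfolding e_def C_def using classes(1)[OF n] g(1) g'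
      by (intro prob_not_unique_minimizer_le[OF W[OF n] R y n2 _ _ g(2) _ g'_pos \<sigma>(2,3) \<sigma>(1)[OF n]]) blast+
    then show ?thesis
      using estimator_eq_ge[OF z[OF n] X(2)[OF n] X(1)[OF n] R W[OF n]] by linarith
  qed
  have upper: "measure (M n) {\<omega> \<in> space (M n). z n \<omega> = y n} \<le> 1" if n: "n \<ge> k" for n
  proof -
    interpret prob_space "M n"
      using M n by simp
    show ?thesis
      by (rule prob_le_1)
  qed
  have lim: "(\<lambda>n. 1 - e n) \<longlonglongrightarrow> 1"
    using tendsto_diff[OF tendsto_const[of 1] e] by simp
  show ?thesis
  proof (rule tendsto_sandwich[OF _ _ lim tendsto_const])
    show "\<forall>\<^sub>F n in sequentially. 1 - e n \<le> measure (M n) {\<omega> \<in> space (M n). z n \<omega> = y n}"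
      using lower by (rule eventually_sequentiallyI)
    show "\<forall>\<^sub>F n in sequentially. measure (M n) {\<omega> \<in> space (M n). z n \<omega> = y n} \<le> 1"
      using upper by (rule eventually_sequentiallyI)
  qed
qed

subsection \<open>Extremes of the row sums\<close>

text \<open>The positions in row \<open>u\<close> and column \<open>u\<close> whose other index lies
  in \<open>A\<close>: the noise entries that enter the part of the row sum over
  \<open>A\<close>.\<close>

definition cross :: "nat \<Rightarrow> nat set \<Rightarrow> (nat \<times> nat) set" where
  "cross u A = {u} \<times> A \<union> A \<times> {u}"

lemma finite_cross: "finite A \<Longrightarrow> finite (cross u A)"
  by (simp add: cross_def)

lemma card_cross:
  assumes "finite A" "u \<notin> A"
  shows "card (cross u A) = 2 * card A"
  unfolding cross_def using assms by (subst card_Un_disjoint) auto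

text \<open>Rewrites a partial row sum as a linear form over positions. Since \<open>u\<close> is
  outside \<open>A\<close>, row and column part are disjoint and the first coordinate determines the
  sign.\<close>

lemma sum_cross:
  fixes s :: real
  assumes "finite A" "u \<notin> A"
  shows "(\<Sum>j\<in>A. s * (w u j - w j u)) = (\<Sum>p\<in>cross u A. (if fst p = u then s else - s) * w (fst p) (snd p))"
proof -
  have "(\<Sum>p\<in>cross u A. (if fst p = u then s else - s) * w (fst p) (snd p))
      = (\<Sum>p\<in>{u} \<times> A. s * w (fst p) (snd p)) + (\<Sum>p\<in>A \<times> {u}. - s * w (fst p) (snd p))"
    unfolding cross_def using assms
    by (subst sum.union_disjoint) (auto intro!: arg_cong2[where f = "(+)"] sum.cong)
  also have "\<dots> = (\<Sum>j\<in>A. s * w u j) + (\<Sum>j\<in>A. - s * w j u)"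
    by (simp add: sum.cartesian_product')
  finally show ?thesis
    by (simp add: algebra_simps sum.distrib sum_negf sum_subtractf)
qed

lemma (in prob_space) prob_vimage_atMost:
  fixes X :: "'a \<Rightarrow> real"
  assumes X: "X \<in> borel_measurable M"
  shows "prob (X -` {..t} \<inter> space M) = 1 - prob {\<omega> \<in> space M. t < X \<omega>}"
proof -
  have "X -` {..t} \<inter> space M \<in> events"
    by (rule measurable_sets[OF X]) simp
  moreover have "{\<omega> \<in> space M. t < X \<omega>} = space M - (X -` {..t} \<inter> space M)"
    by auto
  ultimately show ?thesis
    by (simp add: prob_compl)
qed

text \<open>The sums over the complement of \<open>S\<close> are independent with variance
  \<open>2 * (n - card S)\<close>. Each stays below \<open>t\<close> with probability at most
  \<open>1 - q \<le> exp (- q)\<close>, where \<open>q\<close> is the Gaussian lower tail bound; the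
  product over \<open>S\<close> gives the claim.\<close>

lemma (in prob_space) prob_all_cross_sums_le:
  fixes s t :: real
  assumes W: "iid_std_gaussian_matrix M n W"
    and S: "S \<subseteq> {1..n}" "card S < n" and s: "s\<^sup>2 = 1" and t: "0 \<le> t"
  shows "prob {\<omega> \<in> space M. \<forall>u\<in>S. (\<Sum>j\<in>{1..n} - S. s * (W u j \<omega> - W j u \<omega>)) \<le> t}
    \<le> exp (- real (card S) * (exp (- (t / sqrt (2 * (real n - real (card S))) + 1)\<^sup>2 / 2) / sqrt (2 * pi)))"
proof (cases "S = {}")
  case False
  let ?A = "{1..n} - S"
  let ?a = "\<lambda>u p. if fst p = u then s else - s"
  let ?Y = "\<lambda>u \<omega>. \<Sum>p\<in>cross u ?A. ?a u p * W (fst p) (snd p) \<omega>"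
  let ?q = "exp (- (t / sqrt (2 * (real n - real (card S))) + 1)\<^sup>2 / 2) / sqrt (2 * pi)"
  have finS: "finite S"
    using S finite_subset by auto
  have Y_eq: "(\<Sum>j\<in>?A. s * (W u j \<omega> - W j u \<omega>)) = ?Y u \<omega>" if "u \<in> S" for u \<omega>
    using that sum_cross[of ?A u s "\<lambda>i j. W i j \<omega>"] by auto
  have cross_sub: "cross u ?A \<subseteq> {1..n} \<times> {1..n}" if "u \<in> S" for u
    using that S by (auto simp: cross_def)
  note ind = iid_std_gaussian_matrixD[OF W]
  \<comment> \<open>For distinct vertices of \<open>S\<close> the crosses are disjoint, because
    their other indices avoid \<open>S\<close>. Grouping the entries by cross preserves
    independence.\<close>
  have "indep_vars (\<lambda>u. PiM (cross u ?A) (\<lambda>_. borel))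
      (\<lambda>u \<omega>. restrict (\<lambda>p. W (fst p) (snd p) \<omega>) (cross u ?A)) S"
    by (rule indep_vars_restrict[OF ind(1)]) (use cross_sub in \<open>auto simp: disjoint_family_on_def cross_def\<close>)
  then have "indep_vars (\<lambda>_. borel)
      (\<lambda>u \<omega>. \<Sum>p\<in>cross u ?A. ?a u p * restrict (\<lambda>p. W (fst p) (snd p) \<omega>) (cross u ?A) p) S"
    by (rule indep_vars_compose2[where Y = "\<lambda>u f. \<Sum>p\<in>cross u ?A. ?a u p * f p"]) measurable
  then have indY: "indep_vars (\<lambda>_. borel) ?Y S"
    by (simp cong: sum.cong)
  have Y_meas: "?Y u \<in> borel_measurable M" if "u \<in> S" for u
    using cross_sub[OF that]
    by (intro borel_measurable_sum borel_measurable_times borel_measurable_const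
        gaussian_matrix_measurable[OF W]) auto
  have "prob {\<omega> \<in> space M. \<forall>u\<in>S. (\<Sum>j\<in>?A. s * (W u j \<omega> - W j u \<omega>)) \<le> t}
      = prob (\<Inter>u\<in>S. ?Y u -` {..t} \<inter> space M)"
    using False Y_eq by (intro arg_cong[where f = prob]) auto
  also have "\<dots> = (\<Prod>u\<in>S. prob (?Y u -` {..t} \<inter> space M))"
    using indY False finS by (intro indep_varsD_finite) auto
  also have "\<dots> \<le> (\<Prod>u\<in>S. exp (- ?q))"
  proof (intro prod_mono conjI measure_nonneg)
    fix u assume u: "u \<in> S"
    have "card ?A = n - card S"
      using S finS by (simp add: card_Diff_subset)
    then have "2 * (real n - real (card S)) = (\<Sum>p\<in>cross u ?A. (?a u p)\<^sup>2)"
      using u S s by (simp add: card_cross if_distrib[of "\<lambda>x. x\<^sup>2"] of_nat_diff cong: if_cong)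
    then have "?q \<le> prob {\<omega> \<in> space M. t < ?Y u \<omega>}"
      using S t u cross_sub[OF u] ind
      by (intro linear_form_lower_tail indep_vars_subset[OF ind(1)]) (auto simp: finite_cross)
    moreover have "prob (?Y u -` {..t} \<inter> space M) = 1 - prob {\<omega> \<in> space M. t < ?Y u \<omega>}"
      by (rule prob_vimage_atMost[OF Y_meas[OF u]])
    ultimately have "prob (?Y u -` {..t} \<inter> space M) \<le> 1 - ?q"
      by linarith
    also have "\<dots> \<le> exp (- ?q)"
      using exp_ge_add_one_self[of "- ?q"] by simp
    finally show "prob (?Y u -` {..t} \<inter> space M) \<le> exp (- ?q)" .
  qed
  also have "\<dots> = exp (- real (card S) * ?q)"
    by (simp add: exp_of_nat_mult[symmetric])
  finally show ?thesis .
qed simp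

text \<open>The diagonal term \<open>j = u\<close> cancels, which leaves a linear form of variance
  \<open>2 * (card S - 1)\<close>.\<close>

lemma (in prob_space) prob_cross_sum_upper_tail:
  fixes s b :: real
  assumes W: "iid_std_gaussian_matrix M n W"
    and S: "S \<subseteq> {1..n}" "u \<in> S" and s: "s\<^sup>2 = 1" and b: "0 \<le> b"
  shows "prob {\<omega> \<in> space M. b \<le> (\<Sum>j\<in>S. s * (W u j \<omega> - W j u \<omega>))} \<le> exp (- b\<^sup>2 / (4 * real (card S)))"
proof -
  let ?A = "S - {u}"
  let ?a = "\<lambda>p. if fst p = u then s else - s"
  note ind = iid_std_gaussian_matrixD[OF W]
  have finS: "finite S"
    using S finite_subset by auto
  have sub: "cross u ?A \<subseteq> {1..n} \<times> {1..n}"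
    using S by (auto simp: cross_def)
  have "(\<Sum>j\<in>S. s * (W u j \<omega> - W j u \<omega>)) = (\<Sum>p\<in>cross u ?A. ?a p * W (fst p) (snd p) \<omega>)" for \<omega>
    using sum_cross[of ?A u s "\<lambda>i j. W i j \<omega>"] finS S by (subst sum.remove[of _ u]) auto
  moreover have "prob {\<omega> \<in> space M. b \<le> (\<Sum>p\<in>cross u ?A. ?a p * W (fst p) (snd p) \<omega>)}
      \<le> exp (- b\<^sup>2 / (2 * (2 * real (card S))))"
  proof (intro linear_form_upper_tail indep_vars_subset[OF ind(1)])
    show "(\<Sum>p\<in>cross u ?A. (?a p)\<^sup>2) \<le> 2 * real (card S)"
      using s finS card_Diff1_le[of S u] by (simp add: card_cross if_distrib[of "\<lambda>x. x\<^sup>2"] cong: if_cong)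
    show "0 < 2 * real (card S)"
      using finS S by (auto simp: card_gt_0_iff)
  qed (use finS sub b ind in \<open>auto simp: finite_cross\<close>)
  ultimately show ?thesis
    by simp
qed

text \<open>If every row sum is at most \<open>\<theta>\<close>, then either all independent outer
  parts are at most \<open>\<theta> + b\<close>, or some inner part is at most \<open>- b\<close>.
  The second event is small by a union bound that uses no independence.\<close>

lemma (in prob_space) prob_all_row_sums_le:
  fixes s \<theta> b :: real
  assumes W: "iid_std_gaussian_matrix M n W"
    and S: "S \<subseteq> {1..n}" "card S < n" and s: "s\<^sup>2 = 1" and \<theta>: "0 \<le> \<theta>" and b: "0 \<le> b"
  shows "prob {\<omega> \<in> space M. \<forall>u\<in>S. s * (\<Sum>j\<in>{1..n}. W u j \<omega> - W j u \<omega>) \<le> \<theta>}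
    \<le> exp (- real (card S) * (exp (- ((\<theta> + b) / sqrt (2 * (real n - real (card S))) + 1)\<^sup>2 / 2) / sqrt (2 * pi)))
      + real (card S) * exp (- b\<^sup>2 / (4 * real (card S)))"
proof -
  let ?Y = "\<lambda>u \<omega>. \<Sum>j\<in>{1..n} - S. s * (W u j \<omega> - W j u \<omega>)"
  \<comment> \<open>Negated, so that a very negative inner part becomes an upper tail event.\<close>
  let ?Z = "\<lambda>u \<omega>. \<Sum>j\<in>S. - s * (W u j \<omega> - W j u \<omega>)"
  let ?E = "{\<omega> \<in> space M. \<forall>u\<in>S. ?Y u \<omega> \<le> \<theta> + b}"
  let ?F = "\<Union>u\<in>S. {\<omega> \<in> space M. b \<le> ?Z u \<omega>}"
  have finS: "finite S"
    using S finite_subset by auto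
  have Y_meas: "?Y u \<in> borel_measurable M" and Z_meas: "?Z u \<in> borel_measurable M" if "u \<in> S" for u
    using subsetD[OF S(1)] that
    by (auto intro!: borel_measurable_sum borel_measurable_times borel_measurable_diff
        gaussian_matrix_measurable[OF W])
  have E: "?E \<in> events"
    using Y_meas finS by (intro sets.sets_Collect_finite_All borel_measurable_le) auto
  have F: "{\<omega> \<in> space M. b \<le> ?Z u \<omega>} \<in> events" if "u \<in> S" for u
    using Z_meas[OF that] by (intro borel_measurable_le) auto
  have Fs: "?F \<in> events"
    by (intro sets.finite_UN finS F)
  have split: "s * (\<Sum>j\<in>{1..n}. W u j \<omega> - W j u \<omega>) = ?Y u \<omega> - ?Z u \<omega>" if "u \<in> S" for u \<omega>
    using sum.subset_diff[OF S(1), of "\<lambda>j. s * (W u j \<omega> - W j u \<omega>)"]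
    by (simp add: sum_distrib_left sum_negf)
  have "{\<omega> \<in> space M. \<forall>u\<in>S. s * (\<Sum>j\<in>{1..n}. W u j \<omega> - W j u \<omega>) \<le> \<theta>} \<subseteq> ?E \<union> ?F"
  proof
    fix \<omega> assume \<omega>: "\<omega> \<in> {\<omega> \<in> space M. \<forall>u\<in>S. s * (\<Sum>j\<in>{1..n}. W u j \<omega> - W j u \<omega>) \<le> \<theta>}"
    show "\<omega> \<in> ?E \<union> ?F"
    proof (cases "\<exists>u\<in>S. b \<le> ?Z u \<omega>")
      case False
      have "?Y u \<omega> \<le> \<theta> + b" if "u \<in> S" for u
      proof -
        have "?Y u \<omega> - ?Z u \<omega> \<le> \<theta>"
          using \<omega> that split[OF that] by auto
        moreover have "?Z u \<omega> < b"
          using False that by (meson not_le)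
        ultimately show ?thesis
          by linarith
      qed
      then show ?thesis
        using \<omega> by blast
    qed (use \<omega> in blast)
  qed
  then have "prob {\<omega> \<in> space M. \<forall>u\<in>S. s * (\<Sum>j\<in>{1..n}. W u j \<omega> - W j u \<omega>) \<le> \<theta>} \<le> prob (?E \<union> ?F)"
    using E Fs by (intro finite_measure_mono sets.Un)
  also have "\<dots> \<le> prob ?E + prob ?F"
    using E Fs by (rule measure_Un_le)
  also have "prob ?F \<le> (\<Sum>u\<in>S. prob {\<omega> \<in> space M. b \<le> ?Z u \<omega>})"
    by (rule finite_measure_subadditive_finite[OF finS]) (use F in blast)
  also have "\<dots> \<le> (\<Sum>u\<in>S. exp (- b\<^sup>2 / (4 * real (card S))))"
    using s b by (intro sum_mono prob_cross_sum_upper_tail[OF W S(1)]) auto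
  also have "prob ?E \<le> exp (- real (card S) * (exp (- ((\<theta> + b) / sqrt (2 * (real n - real (card S))) + 1)\<^sup>2 / 2) / sqrt (2 * pi)))"
    using s \<theta> b by (intro prob_all_cross_sums_le[OF W S]) auto
  finally show ?thesis
    by simp
qed

section \<open>Choice of the fraction and limit of the bounds\<close>

text \<open>The expected number of exceedances is \<open>n\<close> to the power
  \<open>1 - q\<^sup>2\<close>, up to a factor \<open>exp (- q * sqrt (2 * ln n))\<close> and
  constants. It diverges because \<open>q < 1\<close>.\<close>

lemma row_sum_bound_tendsto_0:
  fixes q \<eta> :: real
  assumes q: "0 \<le> q" "q < 1" and \<eta>: "0 < \<eta>"
  shows "(\<lambda>n. exp (- (\<eta> * real n / 2) * (exp (- (sqrt (2 * ln n) * q + 1)\<^sup>2 / 2) / sqrt (2 * pi))) + 1 / n)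
           \<longlonglongrightarrow> 0"
proof -
  define p where "p = 1 - q\<^sup>2"
  have p: "p > 0"
    using q by (simp add: p_def power_less_one_iff abs_square_less_1)
  have "filterlim (\<lambda>n. \<eta> / 2 / sqrt (2 * pi) * exp (p * ln (real n) - q * sqrt (2 * ln n) - 1 / 2)) at_top sequentially"
    using p q \<eta> by (cases "q = 0"; simp; real_asymp)
  moreover have "\<forall>\<^sub>F n in sequentially. \<eta> / 2 / sqrt (2 * pi) * exp (p * ln (real n) - q * sqrt (2 * ln n) - 1 / 2)
      = \<eta> * real n / 2 * (exp (- (sqrt (2 * ln n) * q + 1)\<^sup>2 / 2) / sqrt (2 * pi))"
    using eventually_ge_at_top[of 1]
  proof eventually_elim
    case (elim n)
    have "(sqrt (2 * ln n) * q + 1)\<^sup>2 / 2 = q\<^sup>2 * ln n + q * sqrt (2 * ln n) + 1 / 2"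
      using elim by (simp add: power2_sum power_mult_distrib algebra_simps)
    then have "p * ln (real n) - q * sqrt (2 * ln n) - 1 / 2 = ln n + - (sqrt (2 * ln n) * q + 1)\<^sup>2 / 2"
      unfolding p_def minus_divide_left[symmetric] by (simp only: algebra_simps)
    then have "exp (p * ln (real n) - q * sqrt (2 * ln n) - 1 / 2) = n * exp (- (sqrt (2 * ln n) * q + 1)\<^sup>2 / 2)"
      using elim by (simp only: exp_add) simp
    then show ?case
      by simp
  qed
  ultimately have "filterlim (\<lambda>n. \<eta> * real n / 2 * (exp (- (sqrt (2 * ln n) * q + 1)\<^sup>2 / 2) / sqrt (2 * pi)))
      at_top sequentially"
    by (rule filterlim_cong[OF refl refl, THEN iffD1, rotated])
  then have "(\<lambda>n. exp (- (\<eta> * real n / 2 * (exp (- (sqrt (2 * ln n) * q + 1)\<^sup>2 / 2) / sqrt (2 * pi))))) \<longlonglongrightarrow> 0"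
    by (intro filterlim_compose[OF exp_at_bot] filterlim_compose[OF filterlim_uminus_at_bot_at_top])
  from tendsto_add[OF this lim_1_over_n] show ?thesis
    by simp
qed

text \<open>The quotient is the threshold in normalised units: \<open>sqrt (2 * \<eta>)\<close> pays
  for the inner parts, \<open>sqrt (1 - \<eta>)\<close> for the variance they take away. It tends to
  \<open>sqrt \<rho> < 1\<close> as \<open>\<eta>\<close> tends to 0.\<close>

lemma ex_small_fraction:
  fixes \<rho> \<kappa> :: real
  assumes "\<rho> < 1" "0 < \<kappa>"
  shows "\<exists>\<eta>. 0 < \<eta> \<and> \<eta> < \<kappa> \<and> \<eta> < 1 \<and> (sqrt \<rho> + sqrt (2 * \<eta>)) / sqrt (1 - \<eta>) < 1"
proof -
  have "((\<lambda>\<eta>. (sqrt \<rho> + sqrt (2 * \<eta>)) / sqrt (1 - \<eta>)) \<longlongrightarrow> (sqrt \<rho> + sqrt (2 * 0)) / sqrt (1 - 0)) (at_right 0)"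
    by (intro tendsto_intros) auto
  then have "\<forall>\<^sub>F \<eta> in at_right 0. (sqrt \<rho> + sqrt (2 * \<eta>)) / sqrt (1 - \<eta>) < 1"
    using assms by (elim order_tendstoD) simp
  moreover have "\<forall>\<^sub>F \<eta>::real in at_right 0. \<eta> \<in> {0<..<min \<kappa> 1}"
    using assms by (intro eventually_at_right_real) auto
  ultimately have "\<forall>\<^sub>F \<eta> in at_right 0. 0 < \<eta> \<and> \<eta> < \<kappa> \<and> \<eta> < 1 \<and> (sqrt \<rho> + sqrt (2 * \<eta>)) / sqrt (1 - \<eta>) < 1"
    by eventually_elim auto
  then show ?thesis
    by (rule eventually_happens'[rotated]) simp
qed

text \<open>Restricting the condition from \<open>A\<close> to a subset \<open>S\<close> of about
  \<open>\<eta> * n\<close> vertices only enlarges the event, and makes the inner sums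
  short.\<close>

lemma (in prob_space) prob_all_row_sums_le_explicit:
  fixes s \<theta> \<rho> \<eta> :: real
  assumes W: "iid_std_gaussian_matrix M n W"
    and A: "A \<subseteq> {1..n}" "\<eta> * n \<le> card A" and s: "s\<^sup>2 = 1"
    and \<eta>: "0 < \<eta>" "\<eta> < 1" "2 \<le> \<eta> * n"
    and \<theta>: "0 \<le> \<theta>" "\<theta>\<^sup>2 \<le> 4 * \<rho> * n * ln n"
  defines "q \<equiv> (sqrt \<rho> + sqrt (2 * \<eta>)) / sqrt (1 - \<eta>)"
  shows "prob {\<omega> \<in> space M. \<forall>u\<in>A. s * (\<Sum>j\<in>{1..n}. W u j \<omega> - W j u \<omega>) \<le> \<theta>}
    \<le> exp (- (\<eta> * real n / 2) * (exp (- (sqrt (2 * ln n) * q + 1)\<^sup>2 / 2) / sqrt (2 * pi))) + 1 / n"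
proof -
  define l where "l = nat \<lfloor>\<eta> * n\<rfloor>"
  \<comment> \<open>This \<open>b\<close> makes each inner sum exceed it with probability at most \<open>1 / n\<^sup>2\<close>.\<close>
  define b where "b = sqrt (8 * \<eta> * n * ln n)"
  have "\<eta> * n \<le> 1 * real n"
    using \<eta> by (intro mult_right_mono) auto
  then have n: "n \<ge> 2"
    using \<eta> by linarith
  then have ln: "ln (real n) > 0"
    by simp
  \<comment> \<open>Rounding down costs less than 1, which is at most half of
    \<open>\<eta> * n\<close> by \<open>2 \<le> \<eta> * n\<close>.\<close>
  have l: "real l \<le> \<eta> * n" "\<eta> * n / 2 \<le> real l" "0 < l"
    using \<eta> unfolding l_def by linarith+
  have "\<eta> * n < n"
    using \<eta> n by simp
  have "l < n" "l \<le> card A"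
    using l A \<open>\<eta> * n < n\<close> by linarith+
  then obtain S where S: "S \<subseteq> A" "card S = l"
    using obtain_subset_with_card_n by blast
  have b: "0 \<le> b" "b\<^sup>2 = 8 * \<eta> * n * ln n"
    using \<eta> ln by (auto simp: b_def)
  have SA: "S \<subseteq> {1..n}"
    using S A by blast
  then have finS: "finite S"
    using finite_subset by auto
  let ?X = "\<lambda>u \<omega>. s * (\<Sum>j\<in>{1..n}. W u j \<omega> - W j u \<omega>)"
  have X: "{\<omega> \<in> space M. ?X u \<omega> \<le> \<theta>} \<in> events" if "u \<in> S" for u
    using subsetD[OF SA that]
    by (intro borel_measurable_le borel_measurable_times borel_measurable_sum borel_measurable_diff
        borel_measurable_const gaussian_matrix_measurable[OF W]) auto
  have "prob {\<omega> \<in> space M. \<forall>u\<in>A. ?X u \<omega> \<le> \<theta>} \<le> prob {\<omega> \<in> space M. \<forall>u\<in>S. ?X u \<omega> \<le> \<theta>}"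
    using S by (intro finite_measure_mono sets.sets_Collect_finite_All X finS) auto
  also have "\<dots> \<le> exp (- real l * (exp (- ((\<theta> + b) / sqrt (2 * (real n - l)) + 1)\<^sup>2 / 2) / sqrt (2 * pi)))
      + real l * exp (- b\<^sup>2 / (4 * real l))"
    using prob_all_row_sums_le[OF W SA _ s \<theta>(1) b(1)] S \<open>l < n\<close> by simp
  also have "exp (- real l * (exp (- ((\<theta> + b) / sqrt (2 * (real n - l)) + 1)\<^sup>2 / 2) / sqrt (2 * pi)))
      \<le> exp (- (\<eta> * real n / 2) * (exp (- (sqrt (2 * ln n) * q + 1)\<^sup>2 / 2) / sqrt (2 * pi)))"
  proof -
    have "\<theta> \<le> sqrt (4 * \<rho> * n * ln n)"
      using \<theta> by (simp add: real_le_rsqrt)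
    have "(\<theta> + b) / sqrt (2 * (real n - l)) \<le> (\<theta> + b) / sqrt (2 * (1 - \<eta>) * n)"
      using \<theta> b l \<eta> \<open>l < n\<close> n by (intro divide_left_mono) (auto simp: algebra_simps)
    also have "\<dots> \<le> (sqrt (4 * \<rho> * n * ln n) + b) / sqrt (2 * (1 - \<eta>) * n)"
      using \<open>\<theta> \<le> _\<close> \<eta> by (intro divide_right_mono) auto
    also have "\<dots> = sqrt (2 * ln n) * q"
    proof -
      \<comment> \<open>The factor \<open>sqrt (2 * n)\<close> is pulled out of every root; after it
        cancels, \<open>q\<close> is what remains besides \<open>sqrt (2 * ln n)\<close>.\<close>
      have "sqrt (4 * \<rho> * n * ln n) = sqrt (2 * ln n) * sqrt \<rho> * sqrt (2 * n)"
        by (simp flip: real_sqrt_mult add: mult_ac)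
      moreover have "b = sqrt (2 * ln n) * sqrt (2 * \<eta>) * sqrt (2 * n)"
        unfolding b_def by (simp flip: real_sqrt_mult add: mult_ac)
      moreover have "sqrt (2 * (1 - \<eta>) * n) = sqrt (1 - \<eta>) * sqrt (2 * n)"
        by (simp flip: real_sqrt_mult add: mult_ac)
      ultimately have "(sqrt (4 * \<rho> * n * ln n) + b) / sqrt (2 * (1 - \<eta>) * n)
          = (sqrt (2 * ln n) * (sqrt \<rho> + sqrt (2 * \<eta>)) * sqrt (2 * n)) / (sqrt (1 - \<eta>) * sqrt (2 * n))"
        by (simp add: algebra_simps)
      then show ?thesis
        using n by (simp add: q_def)
    qed
    finally have "(\<theta> + b) / sqrt (2 * (real n - l)) \<le> sqrt (2 * ln n) * q" .
    then have "((\<theta> + b) / sqrt (2 * (real n - l)) + 1)\<^sup>2 \<le> (sqrt (2 * ln n) * q + 1)\<^sup>2"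
      using \<theta> b \<open>l < n\<close> by (intro power_mono) auto
    then have "(\<eta> * real n / 2) * (exp (- (sqrt (2 * ln n) * q + 1)\<^sup>2 / 2) / sqrt (2 * pi))
        \<le> real l * (exp (- ((\<theta> + b) / sqrt (2 * (real n - l)) + 1)\<^sup>2 / 2) / sqrt (2 * pi))"
      using l by (intro mult_mono divide_right_mono) auto
    then show ?thesis
      by simp
  qed
  also have "real l * exp (- b\<^sup>2 / (4 * real l)) \<le> 1 / n"
  proof -
    have "2 * ln n * (4 * real l) \<le> b\<^sup>2"
      using mult_right_mono[OF l(1), of "8 * ln n"] ln unfolding b(2) by (simp add: algebra_simps)
    then have "2 * ln n \<le> b\<^sup>2 / (4 * real l)"
      using l by (simp add: pos_le_divide_eq)
    then have "exp (- b\<^sup>2 / (4 * real l)) \<le> exp (- (ln n + ln n))"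
      by simp
    also have "\<dots> = 1 / (real n * real n)"
      using n by (simp only: exp_minus exp_add) (simp add: field_simps)
    finally have "real l * exp (- b\<^sup>2 / (4 * real l)) \<le> n * (1 / (real n * real n))"
      using \<open>l < n\<close> by (intro mult_mono) auto
    then show ?thesis
      using n by simp
  qed
  finally show ?thesis
    by simp
qed

text \<open>A row sum has standard deviation about \<open>sqrt (2 * n)\<close>, so the largest of
  order \<open>n\<close> of them is about \<open>sqrt (4 * n * ln n)\<close>. With
  \<open>\<rho> < 1\<close> the threshold stays below this by a constant factor.\<close>

lemma prob_all_row_sums_le_tendsto_0:
  fixes M :: "nat \<Rightarrow> 'w measure" and s \<theta> :: "nat \<Rightarrow> real" and \<rho> \<kappa> :: real
  assumes M: "\<And>n. n \<ge> k \<Longrightarrow> prob_space (M n)"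
    and W: "\<And>n. n \<ge> k \<Longrightarrow> iid_std_gaussian_matrix (M n) n (W n)"
    and A: "\<And>n. n \<ge> k \<Longrightarrow> A n \<subseteq> {1..n}" "\<And>n. n \<ge> k \<Longrightarrow> \<kappa> * n \<le> card (A n)"
    and s: "\<And>n. n \<ge> k \<Longrightarrow> (s n)\<^sup>2 = 1"
    and \<theta>: "\<And>n. n \<ge> k \<Longrightarrow> 0 \<le> \<theta> n" "\<And>n. n \<ge> k \<Longrightarrow> (\<theta> n)\<^sup>2 \<le> 4 * \<rho> * n * ln n"
    and \<rho>: "0 \<le> \<rho>" "\<rho> < 1" and \<kappa>: "0 < \<kappa>"
  shows "(\<lambda>n. measure (M n) {\<omega> \<in> space (M n).
           \<forall>u\<in>A n. s n * (\<Sum>j\<in>{1..n}. W n u j \<omega> - W n j u \<omega>) \<le> \<theta> n}) \<longlonglongrightarrow> 0"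
proof -
  obtain \<eta> where \<eta>: "0 < \<eta>" "\<eta> < \<kappa>" "\<eta> < 1" "(sqrt \<rho> + sqrt (2 * \<eta>)) / sqrt (1 - \<eta>) < 1"
    using ex_small_fraction[OF \<rho>(2) \<kappa>] by blast
  define q where "q = (sqrt \<rho> + sqrt (2 * \<eta>)) / sqrt (1 - \<eta>)"
  have q: "0 \<le> q" "q < 1"
    using \<eta> \<rho> by (auto simp: q_def)
  have "filterlim (\<lambda>n. \<eta> * real n) at_top sequentially"
    using \<eta> by real_asymp
  then have "\<forall>\<^sub>F n in sequentially. 2 \<le> \<eta> * real n"
    by (simp add: filterlim_at_top)
  then have "\<forall>\<^sub>F n in sequentially. measure (M n) {\<omega> \<in> space (M n).
           \<forall>u\<in>A n. s n * (\<Sum>j\<in>{1..n}. W n u j \<omega> - W n j u \<omega>) \<le> \<theta> n}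
      \<le> exp (- (\<eta> * real n / 2) * (exp (- (sqrt (2 * ln n) * q + 1)\<^sup>2 / 2) / sqrt (2 * pi))) + 1 / n"
    using eventually_ge_at_top[of k]
  proof eventually_elim
    case (elim n)
    interpret prob_space "M n"
      using M elim by simp
    have "\<eta> * n \<le> \<kappa> * n"
      using \<eta> by (intro mult_right_mono) auto
    then have "\<eta> * n \<le> card (A n)"
      using A(2)[OF elim(2)] by linarith
    then show ?case
      unfolding q_def using elim \<eta>
      by (intro prob_all_row_sums_le_explicit[OF W A(1) _ s _ _ _ \<theta>(1) \<theta>(2)]) auto
  qed
  then show ?thesis
    by (intro tendsto_sandwich[OF _ _ tendsto_const row_sum_bound_tendsto_0[OF q \<eta>(1)]]) auto
qed

subsection \<open>Failure above the threshold\<close>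

text \<open>Renaming the indices in the second half collects all noise at the weight
  \<open>d i\<close>, so a \<open>d\<close> supported on two vertices leaves two row sums.\<close>

lemma sum_diff_mult:
  fixes d :: "'i \<Rightarrow> real"
  shows "(\<Sum>(i, j)\<in>A \<times> A. (d i - d j) * w i j) = (\<Sum>i\<in>A. d i * (\<Sum>j\<in>A. w i j - w j i))"
proof -
  have "(\<Sum>(i, j)\<in>A \<times> A. (d i - d j) * w i j) = (\<Sum>i\<in>A. \<Sum>j\<in>A. d i * w i j) - (\<Sum>i\<in>A. \<Sum>j\<in>A. d j * w i j)"
    by (simp add: sum.cartesian_product[symmetric] left_diff_distrib sum_subtractf)
  also have "(\<Sum>i\<in>A. \<Sum>j\<in>A. d j * w i j) = (\<Sum>i\<in>A. \<Sum>j\<in>A. d i * w j i)"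
    by (rule sum.swap)
  finally show ?thesis
    by (simp add: sum_distrib_left right_diff_distrib sum_subtractf)
qed

lemma loss_transpose:
  assumes uv: "u \<in> {1..n}" "v \<in> {1..n}" "u \<noteq> v"
  shows "loss n y s W (y \<circ> Transposition.transpose u v) \<omega> = loss n y s W y \<omega> + 4 * n * (y u - y v)\<^sup>2
     + 2 * (s * (y u - y v)) * ((\<Sum>j\<in>{1..n}. W u j \<omega> - W j u \<omega>) - (\<Sum>j\<in>{1..n}. W v j \<omega> - W j v \<omega>))"
proof -
  define g where "g = y u - y v"
  define d where "d i = y i - (y \<circ> Transposition.transpose u v) i" for i
  have d: "d i = (if i = u then g else 0) + (if i = v then - g else 0)" for i
    using uv by (auto simp: d_def g_def Transposition.transpose_def)
  have sum_d: "(\<Sum>i\<in>{1..n}. d i * f i) = g * (f u - f v)" for f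
    using uv by (simp add: d distrib_right if_distrib[of "\<lambda>x. x * _"] sum.distrib right_diff_distrib cong: if_cong)
  \<comment> \<open>The spread is itself such a form, with weights \<open>d i - d j\<close>, so
    \<open>sum_diff_mult\<close> and \<open>sum_d\<close> evaluate it too.\<close>
  have "spread n d = (\<Sum>i\<in>{1..n}. d i * (\<Sum>j\<in>{1..n}. (d i - d j) - (d j - d i)))"
    unfolding spread_def power2_eq_square by (rule sum_diff_mult)
  also have "\<dots> = (\<Sum>i\<in>{1..n}. d i * (2 * n * d i))"
  proof -
    have "(\<Sum>j\<in>{1..n}. (d i - d j) - (d j - d i)) = 2 * n * d i" for i
    proof -
      have "(\<Sum>j\<in>{1..n}. (d i - d j) - (d j - d i)) = (\<Sum>j\<in>{1..n}. 2 * d i - 2 * d j)"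
        by (intro sum.cong) auto
      then show ?thesis
        using sum_d[of "\<lambda>_. 1"] by (simp add: sum_subtractf flip: sum_distrib_left)
    qed
    then show ?thesis
      by simp
  qed
  also have "\<dots> = 4 * n * g\<^sup>2"
    unfolding sum_d using uv by (simp add: d power2_eq_square)
  finally have "spread n d = 4 * n * g\<^sup>2" .
  moreover have "(\<Sum>(i, j)\<in>{1..n} \<times> {1..n}. (d i - d j) * W i j \<omega>)
      = g * ((\<Sum>j\<in>{1..n}. W u j \<omega> - W j u \<omega>) - (\<Sum>j\<in>{1..n}. W v j \<omega> - W j v \<omega>))"
    unfolding sum_diff_mult by (rule sum_d)
  ultimately show ?thesis
    using loss_diff[of n y s W \<omega> "y \<circ> Transposition.transpose u v"]
    unfolding d_def[symmetric] g_def[symmetric] by (simp only: mult.assoc)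
qed

text \<open>If one vertex of each class has a signed row sum above \<open>\<theta>\<close>,
  exchanging their colours strictly lowers the loss. So \<open>z = y\<close> forces all signed row
  sums of one class to stay at or below \<open>\<theta>\<close>.\<close>

lemma (in prob_space) prob_estimator_eq_le:
  fixes p q s :: real
  assumes W: "iid_std_gaussian_matrix M n W"
    and z: "least_squares_estimator M n (observation y s W) X z"
    and pq: "p \<noteq> q" and s: "s \<noteq> 0"
    and swap: "\<And>u v. \<lbrakk>u \<in> {1..n}; v \<in> {1..n}; y u = p; y v = q\<rbrakk> \<Longrightarrow> y \<circ> Transposition.transpose u v \<in> X"
  defines "\<theta> \<equiv> n * \<bar>p - q\<bar> / \<bar>s\<bar>" and "t \<equiv> - sgn (s * (p - q))"
  shows "prob {\<omega> \<in> space M. z \<omega> = y}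
    \<le> prob {\<omega> \<in> space M. \<forall>u\<in>{i \<in> {1..n}. y i = p}. t * (\<Sum>j\<in>{1..n}. W u j \<omega> - W j u \<omega>) \<le> \<theta>}
      + prob {\<omega> \<in> space M. \<forall>v\<in>{i \<in> {1..n}. y i = q}. - t * (\<Sum>j\<in>{1..n}. W v j \<omega> - W j v \<omega>) \<le> \<theta>}"
proof -
  let ?X = "\<lambda>u \<omega>. \<Sum>j\<in>{1..n}. W u j \<omega> - W j u \<omega>"
  let ?E = "\<lambda>r t. {\<omega> \<in> space M. \<forall>u\<in>{i \<in> {1..n}. y i = r}. t * ?X u \<omega> \<le> \<theta>}"
  define h where "h = s * (p - q)"
  \<comment> \<open>The sign \<open>t\<close> is chosen so that large signed row sums lower the
    loss.\<close>
  have h: "h \<noteq> 0" "h = - \<bar>h\<bar> * t"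
    using pq s by (auto simp: h_def t_def sgn_if abs_if)
  \<comment> \<open>\<open>\<theta>\<close> splits the deterministic cost
    \<open>4 * n * (p - q)\<^sup>2\<close> of an exchange equally between its two vertices.\<close>
  have h\<theta>: "\<bar>h\<bar> * \<theta> = n * (p - q)\<^sup>2"
    using s by (simp add: h_def \<theta>_def abs_mult power2_eq_square)
  have meas: "?E r t \<in> events" for r t
  proof (intro sets.sets_Collect_finite_All)
    fix u assume u: "u \<in> {i \<in> {1..n}. y i = r}"
    then show "{\<omega> \<in> space M. t * ?X u \<omega> \<le> \<theta>} \<in> events"
      by (intro borel_measurable_le borel_measurable_times borel_measurable_sum borel_measurable_diff
          borel_measurable_const gaussian_matrix_measurable[OF W]) auto
  qed simp
  have "{\<omega> \<in> space M. z \<omega> = y} \<subseteq> ?E p t \<union> ?E q (- t)"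
  proof (rule subsetI, rule ccontr)
    fix \<omega> assume \<omega>: "\<omega> \<in> {\<omega> \<in> space M. z \<omega> = y}" "\<omega> \<notin> ?E p t \<union> ?E q (- t)"
    then obtain u v where uv: "u \<in> {1..n}" "y u = p" "v \<in> {1..n}" "y v = q"
      and gt: "\<theta> < t * ?X u \<omega>" "\<theta> < - t * ?X v \<omega>"
      by (auto simp: not_le)
    have "u \<noteq> v"
      using uv pq by auto
    have "\<bar>h\<bar> * (\<theta> + \<theta>) < \<bar>h\<bar> * (t * ?X u \<omega> + - t * ?X v \<omega>)"
      using gt h by (intro mult_strict_left_mono) auto
    also have "\<dots> = - (h * (?X u \<omega> - ?X v \<omega>))"
      by (subst (2) h(2)) (simp add: algebra_simps)
    finally have "4 * n * (p - q)\<^sup>2 + 2 * h * (?X u \<omega> - ?X v \<omega>) < 0"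
      using h\<theta> by (simp add: distrib_left)
    then have "loss n y s W (y \<circ> Transposition.transpose u v) \<omega> < loss n y s W y \<omega>"
      using loss_transpose[OF uv(1,3) \<open>u \<noteq> v\<close>, of y s W \<omega>] unfolding uv(2,4) h_def by linarith
    moreover have "y \<circ> Transposition.transpose u v \<in> X"
      using swap uv by blast
    moreover have "is_arg_min (\<lambda>x. loss n y s W x \<omega>) (\<lambda>x. x \<in> X) (z \<omega>)"
      using z \<omega> by (auto simp: least_squares_estimator_def)
    ultimately show False
      using \<omega> by (auto simp: is_arg_min_def)
  qed
  then have "prob {\<omega> \<in> space M. z \<omega> = y} \<le> prob (?E p t \<union> ?E q (- t))"
    by (rule finite_measure_mono) (rule sets.Un[OF meas meas])
  also have "\<dots> \<le> prob (?E p t) + prob (?E q (- t))"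
    by (rule measure_Un_le[OF meas meas])
  finally show ?thesis .
qed

lemma exact_recovery_tendsto_0:
  fixes M :: "nat \<Rightarrow> 'w measure" and \<sigma> :: "nat \<Rightarrow> real" and p q \<kappa> \<delta> :: real
  assumes k: "k \<ge> 2" and M: "\<And>n. n \<ge> k \<Longrightarrow> prob_space (M n)"
    and W: "\<And>n. n \<ge> k \<Longrightarrow> iid_std_gaussian_matrix (M n) n (W n)"
    and pq: "p \<noteq> q"
    and classes: "\<And>n. n \<ge> k \<Longrightarrow> \<kappa> * n \<le> card {i \<in> {1..n}. y n i = p}"
      "\<And>n. n \<ge> k \<Longrightarrow> \<kappa> * n \<le> card {i \<in> {1..n}. y n i = q}" "0 < \<kappa>"
    and \<sigma>: "\<And>n. n \<ge> k \<Longrightarrow> (1 + \<delta>) * n * (p - q)\<^sup>2 / (4 * ln n) \<le> (\<sigma> n)\<^sup>2" "0 < \<delta>"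
    and swap: "\<And>n u v. \<lbrakk>n \<ge> k; u \<in> {1..n}; v \<in> {1..n}\<rbrakk> \<Longrightarrow> y n \<circ> Transposition.transpose u v \<in> X n"
    and z: "\<And>n. n \<ge> k \<Longrightarrow>
      least_squares_estimator (M n) n (observation (y n) (\<sigma> n) (W n)) (X n) (z n)"
  shows "(\<lambda>n. measure (M n) {\<omega> \<in> space (M n). z n \<omega> = y n}) \<longlonglongrightarrow> 0"
proof -
  define t where "t n = - sgn (\<sigma> n * (p - q))" for n
  define \<theta> where "\<theta> n = n * \<bar>p - q\<bar> / \<bar>\<sigma> n\<bar>" for n
  have \<sigma>_pos: "0 < (1 + \<delta>) * n * (p - q)\<^sup>2 / (4 * ln n)" "0 < ln (real n)" if "n \<ge> k" for n
    using that k pq \<sigma>(2) by auto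
  have \<sigma>0: "\<sigma> n \<noteq> 0" if "n \<ge> k" for n
    using \<sigma>(1)[OF that] \<sigma>_pos(1)[OF that] by auto
  have t: "(t n)\<^sup>2 = 1" if "n \<ge> k" for n
    using \<sigma>0[OF that] pq by (auto simp: t_def sgn_if)
  have \<theta>: "0 \<le> \<theta> n" for n
    by (simp add: \<theta>_def)
  \<comment> \<open>The lower bound on the noise turns into the threshold condition with
    \<open>\<rho> = 1 / (1 + \<delta>) < 1\<close>.\<close>
  have \<theta>2: "(\<theta> n)\<^sup>2 \<le> 4 * (1 / (1 + \<delta>)) * n * ln n" if n: "n \<ge> k" for n
  proof -
    have "(\<theta> n)\<^sup>2 = (real n)\<^sup>2 * (p - q)\<^sup>2 / (\<sigma> n)\<^sup>2"
      by (simp add: \<theta>_def power_divide power_mult_distrib)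
    also have "\<dots> \<le> (real n)\<^sup>2 * (p - q)\<^sup>2 / ((1 + \<delta>) * n * (p - q)\<^sup>2 / (4 * ln n))"
      using \<sigma>(1)[OF n] \<sigma>_pos(1)[OF n] \<sigma>0[OF n] by (intro divide_left_mono mult_pos_pos) auto
    also have "\<dots> = 4 * (1 / (1 + \<delta>)) * n * ln n"
      using pq n k by (simp add: power2_eq_square)
    finally show ?thesis .
  qed
  have \<rho>: "0 \<le> 1 / (1 + \<delta>)" "1 / (1 + \<delta>) < 1"
    using \<sigma>(2) by auto
  let ?E = "\<lambda>n r t. measure (M n) {\<omega> \<in> space (M n).
    \<forall>u\<in>{i \<in> {1..n}. y n i = r}. t * (\<Sum>j\<in>{1..n}. W n u j \<omega> - W n j u \<omega>) \<le> \<theta> n}"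
  have "(\<lambda>n. ?E n p (t n)) \<longlonglongrightarrow> 0"
    by (rule prob_all_row_sums_le_tendsto_0[OF M W _ classes(1) t \<theta> \<theta>2 \<rho> classes(3)]) auto
  moreover have "(\<lambda>n. ?E n q (- t n)) \<longlonglongrightarrow> 0"
    by (rule prob_all_row_sums_le_tendsto_0[OF M W _ classes(2) _ \<theta> \<theta>2 \<rho> classes(3)]) (auto simp: t)
  ultimately have lim: "(\<lambda>n. ?E n p (t n) + ?E n q (- t n)) \<longlonglongrightarrow> 0"
    using tendsto_add[of _ 0 _ _ 0] by simp
  have upper: "measure (M n) {\<omega> \<in> space (M n). z n \<omega> = y n} \<le> ?E n p (t n) + ?E n q (- t n)"
    if n: "n \<ge> k" for n
    unfolding t_def \<theta>_def
    by (rule prob_space.prob_estimator_eq_le[OF M[OF n] W[OF n] z[OF n] pq \<sigma>0[OF n] swap[OF n]])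
  show ?thesis
  proof (rule tendsto_sandwich[OF _ _ tendsto_const lim])
    show "\<forall>\<^sub>F n in sequentially. measure (M n) {\<omega> \<in> space (M n). z n \<omega> = y n}
        \<le> ?E n p (t n) + ?E n q (- t n)"
      using upper by (rule eventually_sequentiallyI)
  qed simp
qed

subsection \<open>The sharp threshold\<close>

text \<open>The transposition is an involution of \<open>{1..n}\<close> that maps colour classes
  bijectively, and it fixes all other indices, so extensionality survives.\<close>

lemma transpose_in_sized_assignments:
  assumes y: "y \<in> sized_assignments n k c m" and uv: "u \<in> {1..n}" "v \<in> {1..n}"
  shows "y \<circ> Transposition.transpose u v \<in> sized_assignments n k c m"
proof -
  let ?\<tau> = "Transposition.transpose u v"
  have \<tau>: "?\<tau> i \<in> {1..n} \<longleftrightarrow> i \<in> {1..n}" for i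
    using uv by (auto simp: Transposition.transpose_def)
  have "card {i \<in> {1..n}. (y \<circ> ?\<tau>) i = r} = card {i \<in> {1..n}. y i = r}" for r
  proof (rule bij_betw_same_card)
    show "bij_betw ?\<tau> {i \<in> {1..n}. (y \<circ> ?\<tau>) i = r} {i \<in> {1..n}. y i = r}"
      by (rule bij_betwI[where g = ?\<tau>]) (use \<tau> in auto)
  qed
  moreover have "y \<circ> ?\<tau> \<in> assignments n (c ` {1..k})"
    unfolding assignments_def
  proof (rule PiE_I)
    have y_PiE: "y \<in> {1..n} \<rightarrow>\<^sub>E c ` {1..k}"
      using y by (simp add: sized_assignments_def assignments_def)
    show "(y \<circ> ?\<tau>) i \<in> c ` {1..k}" if "i \<in> {1..n}" for i
      unfolding comp_def using that \<tau> by (intro PiE_mem[OF y_PiE]) simp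
    show "(y \<circ> ?\<tau>) i = undefined" if "i \<notin> {1..n}" for i
      unfolding comp_def using that \<tau> by (intro PiE_arb[OF y_PiE]) simp
  qed
  ultimately show ?thesis
    using y by (simp add: sized_assignments_def)
qed

lemma
  assumes "k \<ge> 2"
  shows min_sq_gap_attained: "\<exists>a b. 1 \<le> a \<and> a < b \<and> b \<le> k \<and> min_sq_gap k c = (c a - c b)\<^sup>2"
    and min_sq_gap_le: "\<lbrakk>i \<in> {1..k}; j \<in> {1..k}; i \<noteq> j\<rbrakk> \<Longrightarrow> min_sq_gap k c \<le> (c i - c j)\<^sup>2"
proof -
  let ?D = "{(c i - c j)\<^sup>2 | i j. 1 \<le> i \<and> i < j \<and> j \<le> k}"
  have "?D \<subseteq> (\<lambda>(i, j). (c i - c j)\<^sup>2) ` ({1..k} \<times> {1..k})"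
    by force
  then have fin: "finite ?D"
    by (rule finite_subset) auto
  have "(c 1 - c 2)\<^sup>2 \<in> ?D"
    using assms by force
  then have "?D \<noteq> {}"
    by blast
  from Min_in[OF fin this] show "\<exists>a b. 1 \<le> a \<and> a < b \<and> b \<le> k \<and> min_sq_gap k c = (c a - c b)\<^sup>2"
    unfolding min_sq_gap_def by blast
  assume ij: "i \<in> {1..k}" "j \<in> {1..k}" "i \<noteq> j"
  then have "(c i - c j)\<^sup>2 \<in> ?D"
  proof (cases "i < j")
    case True
    then show ?thesis
      using ij by (intro CollectI exI[of _ i] exI[of _ j]) auto
  next
    case False
    then have "(c j - c i)\<^sup>2 \<in> ?D"
      using ij by (intro CollectI exI[of _ j] exI[of _ i]) auto
    then show ?thesis
      by (simp only: power2_commute)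
  qed
  then show "min_sq_gap k c \<le> (c i - c j)\<^sup>2"
    unfolding min_sq_gap_def by (rule Min_le[OF fin])
qed

theorem theorem2p1:
  fixes k :: nat and c :: "nat \<Rightarrow> real"
    and m :: "nat \<Rightarrow> nat \<Rightarrow> nat" and \<kappa> :: real
    and y :: "nat \<Rightarrow> nat \<Rightarrow> real" and \<sigma> :: "nat \<Rightarrow> real"
    and M :: "nat \<Rightarrow> 'w measure" and W :: "nat \<Rightarrow> nat \<Rightarrow> nat \<Rightarrow> 'w \<Rightarrow> real"
    and yhat ycheck :: "nat \<Rightarrow> 'w \<Rightarrow> nat \<Rightarrow> real"
  assumes "k \<ge> 2" and "inj_on c {1..k}"
    and "\<And>n i. n \<ge> k \<Longrightarrow> i \<in> {1..k} \<Longrightarrow> m n i > 0"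
    and "\<And>n i j. n \<ge> k \<Longrightarrow> 1 \<le> i \<Longrightarrow> i \<le> j \<Longrightarrow> j \<le> k \<Longrightarrow> m n j \<le> m n i"
    and "\<And>n. n \<ge> k \<Longrightarrow> (\<Sum>i\<in>{1..k}. m n i) = n"
    and "\<kappa> > 0" and "\<And>n. n \<ge> k \<Longrightarrow> real (m n k) / real n \<ge> \<kappa>"
    and "\<And>n. n \<ge> k \<Longrightarrow> y n \<in> sized_assignments n k c (m n)"
    and "\<And>n. n \<ge> k \<Longrightarrow> prob_space (M n)"
    and "\<And>n. n \<ge> k \<Longrightarrow> iid_std_gaussian_matrix (M n) n (W n)"
    and "\<And>n. n \<ge> k \<Longrightarrow> least_squares_estimator (M n) n (observation (y n) (\<sigma> n) (W n))
                         (sized_assignments n k c (m n)) (yhat n)"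
    and "\<And>n. n \<ge> k \<Longrightarrow> least_squares_estimator (M n) n (observation (y n) (\<sigma> n) (W n))
                         (assignments n (c ` {1..k})) (ycheck n)"
  shows "((\<exists>\<delta>>0. \<forall>n\<ge>k. (\<sigma> n)\<^sup>2 < (1 - \<delta>) * real n * min_sq_gap k c / (4 * ln (real n))) \<longrightarrow>
           (\<lambda>n. measure (M n) {\<omega> \<in> space (M n). yhat n \<omega> = y n}) \<longlonglongrightarrow> 1 \<and>
           (\<lambda>n. measure (M n) {\<omega> \<in> space (M n). ycheck n \<omega> = y n}) \<longlonglongrightarrow> 1) \<and>
         ((\<exists>\<delta>>0. \<forall>n\<ge>k. (\<sigma> n)\<^sup>2 > (1 + \<delta>) * real n * min_sq_gap k c / (4 * ln (real n))) \<longrightarrow>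
           (\<lambda>n. measure (M n) {\<omega> \<in> space (M n). yhat n \<omega> = y n}) \<longlonglongrightarrow> 0 \<and>
           (\<lambda>n. measure (M n) {\<omega> \<in> space (M n). ycheck n \<omega> = y n}) \<longlonglongrightarrow> 0)"
proof -
  let ?R = "c ` {1..k}"
  let ?g = "min_sq_gap k c"
  \<comment> \<open>The last class is the smallest, so its linear lower bound holds for every
    class.\<close>
  have size: "\<kappa> * n \<le> card {v \<in> {1..n}. y n v = c i}" if "n \<ge> k" "i \<in> {1..k}" for n i
  proof -
    have "real (m n k) \<ge> \<kappa> * n"
      using assms(7)[OF that(1)] assms(1) that(1) by (simp add: pos_le_divide_eq)
    moreover have "m n k \<le> m n i"
      using assms(4)[OF that(1), of i k] that(2) by auto
    moreover have "card {v \<in> {1..n}. y n v = c i} = m n i"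
      using assms(8)[OF that(1)] that(2) by (auto simp: sized_assignments_def)
    ultimately show ?thesis
      by simp
  qed
  \<comment> \<open>Two colours at minimal distance: the pair to be exchanged above the
    threshold.\<close>
  obtain a b where ab: "1 \<le> a" "a < b" "b \<le> k" "?g = (c a - c b)\<^sup>2"
    using min_sq_gap_attained[OF assms(1)] by blast
  have "c a \<noteq> c b"
    using assms(2) ab by (auto dest: inj_onD)
  then have g_pos: "0 < ?g"
    using ab by simp
  have gap: "?g \<le> (p - q)\<^sup>2" if pq: "p \<in> ?R" "q \<in> ?R" "p \<noteq> q" for p q
  proof -
    obtain i j where "i \<in> {1..k}" "j \<in> {1..k}" "p = c i" "q = c j"
      using pq by blast
    then show ?thesis
      using min_sq_gap_le[OF assms(1), of i j c] pq(3) by auto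
  qed
  have sized: "sized_assignments n k c (m n) \<subseteq> assignments n ?R" for n
    by (auto simp: sized_assignments_def)
  have swap: "y n \<circ> Transposition.transpose u v \<in> sized_assignments n k c (m n)"
    if "n \<ge> k" "u \<in> {1..n}" "v \<in> {1..n}" for n u v
    using assms(8) that by (intro transpose_in_sized_assignments) auto
  have part1: "(\<lambda>n. measure (M n) {\<omega> \<in> space (M n). z n \<omega> = y n}) \<longlonglongrightarrow> 1"
    if \<delta>: "\<delta> > 0" "\<forall>n\<ge>k. (\<sigma> n)\<^sup>2 < (1 - \<delta>) * real n * ?g / (4 * ln (real n))"
      and X: "\<And>n. sized_assignments n k c (m n) \<subseteq> X n" "\<And>n. X n \<subseteq> assignments n ?R"
      and z: "\<And>n. n \<ge> k \<Longrightarrow>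
        least_squares_estimator (M n) n (observation (y n) (\<sigma> n) (W n)) (X n) (z n)"
    for \<delta> X and z :: "nat \<Rightarrow> 'w \<Rightarrow> nat \<Rightarrow> real"
  proof (rule exact_recovery_tendsto_1[OF assms(1,9,10) _ _ assms(6) gap g_pos _ \<delta>(1) _ _ X(2) z])
    \<comment> \<open>Already at \<open>n = k\<close> the bound strictly exceeds a square, hence is
      positive, which forces \<open>\<delta> < 1\<close>.\<close>
    have "0 < (1 - \<delta>) * real k * ?g / (4 * ln (real k))"
      using \<delta>(2) by (meson le_less_trans order_refl zero_le_power2)
    then show "\<delta> < 1"
      using g_pos assms(1) by (simp add: zero_less_divide_iff zero_less_mult_iff)
  next
    fix n assume "n \<ge> k"
    then show "(\<sigma> n)\<^sup>2 \<le> (1 - \<delta>) * real n * ?g / (4 * ln (real n))" "y n \<in> X n"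
      using \<delta>(2) assms(8) X(1) by (auto intro: less_imp_le)
  qed (use size in auto)
  have part2: "(\<lambda>n. measure (M n) {\<omega> \<in> space (M n). z n \<omega> = y n}) \<longlonglongrightarrow> 0"
    if \<delta>: "\<delta> > 0" "\<forall>n\<ge>k. (\<sigma> n)\<^sup>2 > (1 + \<delta>) * real n * ?g / (4 * ln (real n))"
      and X: "\<And>n. sized_assignments n k c (m n) \<subseteq> X n"
      and z: "\<And>n. n \<ge> k \<Longrightarrow>
        least_squares_estimator (M n) n (observation (y n) (\<sigma> n) (W n)) (X n) (z n)"
    for \<delta> X and z :: "nat \<Rightarrow> 'w \<Rightarrow> nat \<Rightarrow> real"
  proof (rule exact_recovery_tendsto_0[OF assms(1,9,10) \<open>c a \<noteq> c b\<close> _ _ assms(6) _ \<delta>(1) _ z])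
    fix n assume n: "n \<ge> k"
    show "(1 + \<delta>) * real n * (c a - c b)\<^sup>2 / (4 * ln (real n)) \<le> (\<sigma> n)\<^sup>2"
      using \<delta>(2) n ab(4) by (auto intro: less_imp_le)
    show "\<kappa> * n \<le> card {i \<in> {1..n}. y n i = c a}" "\<kappa> * n \<le> card {i \<in> {1..n}. y n i = c b}"
      using size[OF n] ab by auto
    show "y n \<circ> Transposition.transpose u v \<in> X n" if "u \<in> {1..n}" "v \<in> {1..n}" for u v
      using swap[OF n that] X by blast
  qed
  \<comment> \<open>Each part is used twice, with \<open>X\<close> the assignments of prescribed
    class sizes and with \<open>X\<close> all assignments.\<close>
  show ?thesis
    using part1[OF _ _ order_refl sized assms(11)] part1[OF _ _ sized order_refl assms(12)]
      part2[OF _ _ order_refl assms(11)] part2[OF _ _ sized assms(12)]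
    by blast
qed

end
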